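(* Let $\Psi$ be an Orlicz function for which there exists $K>0$ such that $\psi(su)\le K(s\ln(1+s)+s\psi(u))$ for all $s,u\ge K$, and let $\Phi$ be the Orlicz function defined by $\Phi(x)=\Psi(x^2)$, $x\ge0$. Then there exists a constant $c_\Phi\in(0,\infty)$, depending only on $\Phi$, such that for every $N\ge1$, every $\mathbb{R}^N$-valued random variable $X=(X_1,\dots,X_N)$ with independent coordinates satisfying $\|\max_{i\le N}|X_i|\|_\Phi<\infty$, every convex and $1$-Lipschitz function $f\colon\mathbb{R}^N\to\mathbb{R}$ and every $t>0$, $$\mathbb{P}\big(|f(X)-\mathbb{E}f(X)|>t\big)\le 2\exp\Big(-c_\Phi\frac{t^2}{(\mathbb{E}\max_{i\le N}|X_i|)^2}\Big)+\frac{2}{\Phi\Big(c_\Phi\frac{t}{\|\max_{i\le N}|X_i|\|_\Phi}\Big)+1}.$$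
   Context: An Orlicz function is a function $\Psi\colon[0,\infty)\to[0,\infty)$ which is convex, strictly increasing and satisfies $\Psi(0)=0$. With it one associates $\psi\colon[0,\infty)\to[0,\infty)$ defined by $\Psi(x)=e^{\psi(x)}-1$. For an Orlicz function $\Phi$ and a real random variable $Y$, $\|Y\|_{\Phi}=\inf\{a>0\colon\mathbb{E}\,\Phi(|Y|/a)\le1\}$. The Lipschitz condition is with respect to the standard Euclidean norm on $\mathbb{R}^N$. In the trivial case $X=0$ almost surely (when denominators vanish) the inequality is regarded as satisfied. *)

theory Defs
  imports "HOL-Probability.Probability"
begin

definition orlicz_function :: "(real \<Rightarrow> real) \<Rightarrow> bool" where
  "orlicz_function \<Psi> \<longleftrightarrow>
     (\<forall>x\<ge>0. 0 \<le> \<Psi> x) \<and> convex_on {0..} \<Psi> \<and> strict_mono_on {0..} \<Psi> \<and> \<Psi> 0 = 0"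

text \<open>The value is \<open>\<infinity>\<close> when no \<open>a\<close> is admissible.\<close>

definition orlicz_norm :: "(real \<Rightarrow> real) \<Rightarrow> 'a measure \<Rightarrow> ('a \<Rightarrow> real) \<Rightarrow> ennreal" where
  "orlicz_norm \<Phi> M Y =
     Inf {ennreal a | a. 0 < a \<and> (\<integral>\<^sup>+ \<omega>. ennreal (\<Phi> (\<bar>Y \<omega>\<bar> / a)) \<partial>M) \<le> 1}"

text \<open>The space \<open>\<real>\<^sup>N\<close>, for \<open>N\<close> a variable, consists of the extensional functions on \<open>{..<N}\<close>;
  coordinates are numbered from \<open>0\<close>.\<close>

definition Rn :: "nat \<Rightarrow> (nat \<Rightarrow> real) set" where
  "Rn N = {..<N} \<rightarrow>\<^sub>E UNIV"

definition convex_Rn :: "nat \<Rightarrow> ((nat \<Rightarrow> real) \<Rightarrow> real) \<Rightarrow> bool" where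
  "convex_Rn N f \<longleftrightarrow>
     (\<forall>x\<in>Rn N. \<forall>y\<in>Rn N. \<forall>u\<in>{0..1}.
        f (\<lambda>i\<in>{..<N}. (1 - u) * x i + u * y i) \<le> (1 - u) * f x + u * f y)"

definition lipschitz_Rn :: "real \<Rightarrow> nat \<Rightarrow> ((nat \<Rightarrow> real) \<Rightarrow> real) \<Rightarrow> bool" where
  "lipschitz_Rn L N f \<longleftrightarrow>
     (\<forall>x\<in>Rn N. \<forall>y\<in>Rn N. \<bar>f x - f y\<bar> \<le> L * L2_set (\<lambda>i. x i - y i) {..<N})"

definition rvec :: "nat \<Rightarrow> (nat \<Rightarrow> 'a \<Rightarrow> real) \<Rightarrow> 'a \<Rightarrow> (nat \<Rightarrow> real)" where
  "rvec N X \<omega> = (\<lambda>i\<in>{..<N}. X i \<omega>)"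

definition max_abs :: "nat \<Rightarrow> (nat \<Rightarrow> 'a \<Rightarrow> real) \<Rightarrow> 'a \<Rightarrow> real" where
  "max_abs N X \<omega> = (MAX i\<in>{..<N}. \<bar>X i \<omega>\<bar>)"

text \<open>If \<open>X = 0\<close> almost surely, both quotients are \<open>0\<close> because \<open>x / 0 = 0\<close>; the right-hand side
  is then at least \<open>2\<close>, so the inequality holds, as it should in this degenerate case.\<close>

definition convex_concentration :: "(real \<Rightarrow> real) \<Rightarrow> real \<Rightarrow> 'a measure \<Rightarrow> bool" where
  "convex_concentration \<Phi> c M \<longleftrightarrow>
     (\<forall>N\<ge>1. \<forall>X f. \<forall>t>0.
        prob_space.indep_vars M (\<lambda>_. borel) X {..<N} \<longrightarrow>
        orlicz_norm \<Phi> M (max_abs N X) < \<infinity> \<longrightarrow>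
        convex_Rn N f \<longrightarrow>
        lipschitz_Rn 1 N f \<longrightarrow>
        \<P>(\<omega> in M. \<bar>f (rvec N X \<omega>) - (\<integral>\<omega>'. f (rvec N X \<omega>') \<partial>M)\<bar> > t)
          \<le> 2 * exp (- c * (t\<^sup>2 / (\<integral>\<omega>. max_abs N X \<omega> \<partial>M)\<^sup>2))
            + 2 / (\<Phi> (c * (t / enn2real (orlicz_norm \<Phi> M (max_abs N X)))) + 1))"

text \<open>A formula cannot quantify over the type of the sample space, so a constant bound by an
  existential quantifier in front of \<open>M :: 'a measure\<close> could depend on \<open>'a\<close>. To express that the
  constant depends on \<open>\<Phi>\<close> alone, it is a function of \<open>\<Phi>\<close>, in whose definition the sample spaces
  are those over \<open>nat \<Rightarrow> real\<close>, a type that carries every joint law of finitely many real random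
  variables.\<close>

definition concentration_const :: "(real \<Rightarrow> real) \<Rightarrow> real" where
  "concentration_const \<Phi> =
     (SOME c. 0 < c \<and>
        (\<forall>M :: (nat \<Rightarrow> real) measure. prob_space M \<longrightarrow> convex_concentration \<Phi> c M))"

end

theory Submission
  imports Defs
begin

text \<open>
Let \<open>R\<close> be the maximum of the \<open>\<bar>X i\<bar>\<close> and \<open>m\<close> its mean. Every coordinate is truncated at the level \<open>2 * m\<close>:
\<open>Y i\<close> equals \<open>X i\<close> where \<open>\<bar>X i\<bar> \<le> 2 * m\<close> and \<open>0\<close> elsewhere. The two terms of the inequality come from the
fluctuations of \<open>f Y\<close> and from the error \<open>f X - f Y\<close>.

The function \<open>f Y\<close> is a convex Lipschitz function of bounded independent variables. It has Gaussian
concentration at the scale \<open>m\<close>, with no dependence on the dimension. This is obtained from Maurey's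
inequality: for a convex \<open>g\<close> and its infimum convolution \<open>Q g\<close> with a quadratic cost, the integrals of
\<open>exp (Q g)\<close> and \<open>exp (- g)\<close> under a product measure on a cube have a product of at most \<open>1\<close>
(\<open>inf_conv_exp_integral\<close>). Applied to a multiple of \<open>f\<close> it bounds the exponential moments of both tails
around the mean (\<open>convex_concentration_bounded\<close>).

The error is at most the Euclidean norm of \<open>X - Y\<close>, whose square is a sum of independent nonnegative
variables. By Markov's inequality all of them vanish with probability at least \<open>1 / 2\<close>. Then their sum is
comparable to their maximum in a strong sense: the expectations of \<open>exp (\<psi> (w))\<close> over the non-zero terms
\<open>w\<close>, scaled by the squared Orlicz norm, have a bounded sum (\<open>sparse_orlicz_weight_sum\<close>), and under the
growth condition on \<open>\<psi>\<close> Chernoff's method turns this into a tail of order \<open>1 / (1 + \<Psi>)\<close> for the sum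
(\<open>sum_tail_bound\<close>). The growth condition ensures that, up to constants, many moderate terms do not contribute
more to this tail than a single large one.

Both parts hold with explicit constants on every probability space. The constant in the theorem is a choice
that refers to one particular type of sample spaces; as only the joint law of the coordinates matters, its
validity carries over to all others (\<open>convex_concentration_transfer\<close>).
\<close>

section \<open>Infimum convolution with a quadratic cost\<close>

text \<open>Functions of finitely many variables are functions on the whole type \<open>'i \<Rightarrow> real\<close>; a Lipschitz bound
that involves only the coordinates in \<open>I\<close> makes them independent of the other ones. In this form a
function of \<open>insert k I\<close> becomes a function of \<open>I\<close> by fixing the coordinate \<open>k\<close>, as the induction on
the number of variables requires.\<close>

definition lipschitz_coords :: "'i set \<Rightarrow> real \<Rightarrow> (('i \<Rightarrow> real) \<Rightarrow> real) \<Rightarrow> bool" where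
  "lipschitz_coords I L g \<longleftrightarrow> (\<forall>x y. \<bar>g x - g y\<bar> \<le> L * L2_set (\<lambda>i. x i - y i) I)"

definition convex_coords :: "(('i \<Rightarrow> real) \<Rightarrow> real) \<Rightarrow> bool" where
  "convex_coords g \<longleftrightarrow> (\<forall>x y. \<forall>u\<in>{0..1}.
     g (\<lambda>i. (1 - u) * x i + u * y i) \<le> (1 - u) * g x + u * g y)"

definition inf_conv :: "real \<Rightarrow> 'i set \<Rightarrow> (('i \<Rightarrow> real) \<Rightarrow> real) \<Rightarrow> ('i \<Rightarrow> real) \<Rightarrow> real" where
  "inf_conv \<kappa> I g x = (INF y. g y + (\<Sum>i\<in>I. (x i - y i)\<^sup>2) / \<kappa>)"

lemma L2_set_power2: "(L2_set z I)\<^sup>2 = (\<Sum>i\<in>I. (z i)\<^sup>2)"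
  by (simp add: L2_set_def sum_nonneg)

lemma lipschitz_coords_cong:
  assumes "lipschitz_coords I L g" "\<And>i. i \<in> I \<Longrightarrow> x i = y i"
  shows "g x = g y"
proof -
  have "L2_set (\<lambda>i. x i - y i) I = 0"
    using assms(2) by (simp add: L2_set_def)
  with assms(1) show ?thesis
    unfolding lipschitz_coords_def by (metis abs_le_zero_iff eq_iff_diff_eq_0 mult_zero_right)
qed

text \<open>Moving a distance \<open>d\<close> gains at most \<open>L * d\<close> and costs \<open>d\<^sup>2 / \<kappa>\<close>; completing the square gives the
bound. It makes the infimum finite, and it is where the variance factor \<open>\<kappa> * L\<^sup>2 / 4\<close> of the final
concentration inequality comes from.\<close>

lemma quadratic_cost_lower_bound:
  assumes "lipschitz_coords I L g" "\<kappa> > 0"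
  shows "g x - \<kappa> * L\<^sup>2 / 4 \<le> g y + (\<Sum>i\<in>I. (x i - y i)\<^sup>2) / \<kappa>"
proof -
  define d where "d = L2_set (\<lambda>i. x i - y i) I"
  have "g x - g y \<le> L * d"
    using assms(1) unfolding lipschitz_coords_def d_def by (meson abs_le_D1 order_trans order_refl)
  moreover have "L * d \<le> \<kappa> * L\<^sup>2 / 4 + d\<^sup>2 / \<kappa>"
  proof -
    have "0 \<le> (\<kappa> * L / 2 - d)\<^sup>2 / \<kappa>" using assms(2) by simp
    also have "\<dots> = \<kappa> * L\<^sup>2 / 4 + d\<^sup>2 / \<kappa> - L * d"
      using assms(2) by (simp add: power2_eq_square field_simps)
    finally show ?thesis by simp
  qed
  moreover have "d\<^sup>2 = (\<Sum>i\<in>I. (x i - y i)\<^sup>2)" by (simp add: d_def L2_set_power2)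
  ultimately show ?thesis by simp
qed

lemma inf_conv_bdd:
  assumes "lipschitz_coords I L g" "\<kappa> > 0"
  shows "bdd_below (range (\<lambda>y. g y + (\<Sum>i\<in>I. (x i - y i)\<^sup>2) / \<kappa>))"
  using quadratic_cost_lower_bound[OF assms] by (auto intro!: bdd_belowI2)

lemma inf_conv_le:
  assumes "lipschitz_coords I L g" "\<kappa> > 0"
  shows "inf_conv \<kappa> I g x \<le> g y + (\<Sum>i\<in>I. (x i - y i)\<^sup>2) / \<kappa>"
  unfolding inf_conv_def by (rule cINF_lower[OF inf_conv_bdd[OF assms]]) simp

lemma inf_conv_greatest:
  assumes "\<And>y. m \<le> g y + (\<Sum>i\<in>I. (x i - y i)\<^sup>2) / \<kappa>"
  shows "m \<le> inf_conv \<kappa> I g x"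
  unfolding inf_conv_def by (rule cINF_greatest) (use assms in auto)

lemma inf_conv_ge_lipschitz:
  assumes "lipschitz_coords I L g" "\<kappa> > 0"
  shows "g x - \<kappa> * L\<^sup>2 / 4 \<le> inf_conv \<kappa> I g x"
  by (rule inf_conv_greatest) (rule quadratic_cost_lower_bound[OF assms])

text \<open>A competitor \<open>y\<close> for the point \<open>x'\<close>, translated by \<open>x - x'\<close>, is a competitor for \<open>x\<close> at the same
cost. The Lipschitz property is needed for the measurability of the infimum convolution.\<close>

lemma lipschitz_inf_conv:
  assumes L: "lipschitz_coords I L g" and "\<kappa> > 0"
  shows "lipschitz_coords I L (inf_conv \<kappa> I g)"
proof -
  have *: "inf_conv \<kappa> I g x - L * L2_set (\<lambda>i. x i - x' i) I \<le> inf_conv \<kappa> I g x'" for x x'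
  proof (rule inf_conv_greatest)
    fix y
    have "inf_conv \<kappa> I g x \<le> g (\<lambda>i. y i + (x i - x' i)) + (\<Sum>i\<in>I. (x i - (y i + (x i - x' i)))\<^sup>2) / \<kappa>"
      by (rule inf_conv_le[OF assms])
    moreover have "\<bar>g (\<lambda>i. y i + (x i - x' i)) - g y\<bar> \<le> L * L2_set (\<lambda>i. x i - x' i) I"
      using L[unfolded lipschitz_coords_def, rule_format, of "\<lambda>i. y i + (x i - x' i)" y] by simp
    moreover have "(\<Sum>i\<in>I. (x i - (y i + (x i - x' i)))\<^sup>2) = (\<Sum>i\<in>I. (x' i - y i)\<^sup>2)"
      by (simp add: algebra_simps)
    ultimately show "inf_conv \<kappa> I g x - L * L2_set (\<lambda>i. x i - x' i) I \<le> g y + (\<Sum>i\<in>I. (x' i - y i)\<^sup>2) / \<kappa>"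
      by simp
  qed
  have sym: "L2_set (\<lambda>i. x i - x' i) I = L2_set (\<lambda>i. x' i - x i) I" for x x' :: "'a \<Rightarrow> real"
    by (simp add: L2_set_def power2_commute)
  show ?thesis
    unfolding lipschitz_coords_def
  proof (intro allI)
    fix x y
    show "\<bar>inf_conv \<kappa> I g x - inf_conv \<kappa> I g y\<bar> \<le> L * L2_set (\<lambda>i. x i - y i) I"
      using *[of x y] *[of y x] sym[of x y] by simp
  qed
qed

lemma lipschitz_section:
  assumes "lipschitz_coords (insert k I) L g" "k \<notin> I" "finite I"
  shows "lipschitz_coords I L (\<lambda>x. g (x(k := s)))"
  unfolding lipschitz_coords_def
proof (intro allI)
  fix x y
  have "L2_set (\<lambda>i. (x(k := s)) i - (y(k := s)) i) (insert k I) = L2_set (\<lambda>i. x i - y i) I"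
    using assms(2,3) unfolding L2_set_def by (auto intro!: arg_cong[where f = sqrt] sum.cong)
  then show "\<bar>g (x(k := s)) - g (y(k := s))\<bar> \<le> L * L2_set (\<lambda>i. x i - y i) I"
    using assms(1)[unfolded lipschitz_coords_def, rule_format, of "x(k := s)" "y(k := s)"] by simp
qed

lemma convex_section:
  assumes "convex_coords g"
  shows "convex_coords (\<lambda>x. g (x(k := s)))"
  unfolding convex_coords_def
proof (intro allI ballI)
  fix x y and u :: real assume "u \<in> {0..1}"
  moreover have "(\<lambda>i. (1 - u) * x i + u * y i)(k := s)
     = (\<lambda>i. (1 - u) * (x(k := s)) i + u * (y(k := s)) i)"
    by (auto simp: fun_eq_iff algebra_simps)
  ultimately show "g ((\<lambda>i. (1 - u) * x i + u * y i)(k := s)) \<le> (1 - u) * g (x(k := s)) + u * g (y(k := s))"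
    using assms unfolding convex_coords_def by metis
qed

text \<open>The function that is minimised is jointly convex in the fixed coordinate and in the competitor, and
partial minimisation preserves joint convexity.\<close>

lemma inf_conv_section_convex:
  assumes L: "lipschitz_coords (insert k I) L g" "k \<notin> I" "finite I" and c: "convex_coords g"
    and "\<kappa> > 0" and u: "0 \<le> u" "u \<le> 1"
  shows "inf_conv \<kappa> I (\<lambda>x. g (x(k := (1 - u) * s + u * s'))) x
     \<le> (1 - u) * inf_conv \<kappa> I (\<lambda>x. g (x(k := s))) x + u * inf_conv \<kappa> I (\<lambda>x. g (x(k := s'))) x"
    (is "?l \<le> (1 - u) * ?p + u * ?q")
proof (rule field_le_epsilon)
  fix e :: real assume e: "0 < e"
  have near: "\<exists>y. h y + (\<Sum>i\<in>I. (x i - y i)\<^sup>2) / \<kappa> < inf_conv \<kappa> I h x + e" for h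
    using inf_conv_greatest[where m = "inf_conv \<kappa> I h x + e" and g = h and I = I and x = x and \<kappa> = \<kappa>] e
    by (meson linorder_not_le less_add_same_cancel1)
  obtain y where y: "g (y(k := s)) + (\<Sum>i\<in>I. (x i - y i)\<^sup>2) / \<kappa> < ?p + e" using near[of "\<lambda>x. g (x(k := s))"] by blast
  obtain z where z: "g (z(k := s')) + (\<Sum>i\<in>I. (x i - z i)\<^sup>2) / \<kappa> < ?q + e" using near[of "\<lambda>x. g (x(k := s'))"] by blast
  define w where "w = (\<lambda>i. (1 - u) * y i + u * z i)"
  have "?l \<le> g (w(k := (1 - u) * s + u * s')) + (\<Sum>i\<in>I. (x i - w i)\<^sup>2) / \<kappa>"
    by (rule inf_conv_le[OF lipschitz_section[OF L] \<open>\<kappa> > 0\<close>])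
  moreover have "g (w(k := (1 - u) * s + u * s')) \<le> (1 - u) * g (y(k := s)) + u * g (z(k := s'))"
  proof -
    have "w(k := (1 - u) * s + u * s') = (\<lambda>i. (1 - u) * (y(k := s)) i + u * (z(k := s')) i)"
      by (auto simp: w_def fun_eq_iff)
    then show ?thesis
      using c[unfolded convex_coords_def, rule_format, of u "y(k := s)" "z(k := s')"] u
      by (simp del: fun_upd_apply)
  qed
  moreover have "(\<Sum>i\<in>I. (x i - w i)\<^sup>2) / \<kappa>
      \<le> (1 - u) * ((\<Sum>i\<in>I. (x i - y i)\<^sup>2) / \<kappa>) + u * ((\<Sum>i\<in>I. (x i - z i)\<^sup>2) / \<kappa>)"
  proof -
    have "(\<Sum>i\<in>I. (x i - w i)\<^sup>2) \<le> (\<Sum>i\<in>I. (1 - u) * (x i - y i)\<^sup>2 + u * (x i - z i)\<^sup>2)"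
    proof (rule sum_mono)
      fix i
      have "(1 - u) * (x i - y i)\<^sup>2 + u * (x i - z i)\<^sup>2 - (x i - w i)\<^sup>2 = u * (1 - u) * (y i - z i)\<^sup>2"
        by (simp add: w_def power2_eq_square algebra_simps)
      moreover have "0 \<le> u * (1 - u) * (y i - z i)\<^sup>2" using u by simp
      ultimately show "(x i - w i)\<^sup>2 \<le> (1 - u) * (x i - y i)\<^sup>2 + u * (x i - z i)\<^sup>2" by linarith
    qed
    also have "\<dots> = (1 - u) * (\<Sum>i\<in>I. (x i - y i)\<^sup>2) + u * (\<Sum>i\<in>I. (x i - z i)\<^sup>2)"
      unfolding sum.distrib sum_distrib_left ..
    finally have "(\<Sum>i\<in>I. (x i - w i)\<^sup>2) / \<kappa>
        \<le> ((1 - u) * (\<Sum>i\<in>I. (x i - y i)\<^sup>2) + u * (\<Sum>i\<in>I. (x i - z i)\<^sup>2)) / \<kappa>"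
      using \<open>\<kappa> > 0\<close> by (simp add: divide_right_mono)
    then show ?thesis by (simp add: add_divide_distrib)
  qed
  moreover have "(1 - u) * (g (y(k := s)) + (\<Sum>i\<in>I. (x i - y i)\<^sup>2) / \<kappa>) \<le> (1 - u) * (?p + e)"
    using y u by (intro mult_left_mono) auto
  moreover have "u * (g (z(k := s')) + (\<Sum>i\<in>I. (x i - z i)\<^sup>2) / \<kappa>) \<le> u * (?q + e)"
    using z u by (intro mult_left_mono) auto
  moreover have "(1 - u) * (?p + e) + u * (?q + e) = (1 - u) * ?p + u * ?q + e"
    by (simp add: algebra_simps)
  ultimately show "?l \<le> (1 - u) * ?p + u * ?q + e"
    unfolding distrib_left by linarith
qed

text \<open>The quadratic cost is a sum over the coordinates, so that the infimum over the coordinate \<open>k\<close> may be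
taken last.\<close>

lemma inf_conv_insert_le:
  assumes "lipschitz_coords (insert k I) L g" "k \<notin> I" "finite I" "\<kappa> > 0"
  shows "inf_conv \<kappa> (insert k I) g (x(k := s))
    \<le> inf_conv \<kappa> I (\<lambda>x. g (x(k := s'))) x + (s - s')\<^sup>2 / \<kappa>"
proof -
  have "inf_conv \<kappa> (insert k I) g (x(k := s)) - (s - s')\<^sup>2 / \<kappa>
      \<le> inf_conv \<kappa> I (\<lambda>x. g (x(k := s'))) x"
  proof (rule inf_conv_greatest)
    fix y
    have "inf_conv \<kappa> (insert k I) g (x(k := s))
        \<le> g (y(k := s')) + (\<Sum>i\<in>insert k I. ((x(k := s)) i - (y(k := s')) i)\<^sup>2) / \<kappa>"
      by (rule inf_conv_le) (use assms in auto)
    also have "(\<Sum>i\<in>insert k I. ((x(k := s)) i - (y(k := s')) i)\<^sup>2) = (s - s')\<^sup>2 + (\<Sum>i\<in>I. (x i - y i)\<^sup>2)"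
      using assms(2,3) by (auto intro!: sum.cong)
    finally show "inf_conv \<kappa> (insert k I) g (x(k := s)) - (s - s')\<^sup>2 / \<kappa>
       \<le> g (y(k := s')) + (\<Sum>i\<in>I. (x i - y i)\<^sup>2) / \<kappa>"
      by (simp add: add_divide_distrib del: fun_upd_apply)
  qed
  then show ?thesis by simp
qed

text \<open>Such a function is continuous for the product topology, whose Borel sets form the product
\<open>\<sigma>\<close>-algebra because the index type is countable.\<close>

lemma borel_measurable_lipschitz_coords:
  fixes g :: "('i::countable \<Rightarrow> real) \<Rightarrow> real"
  assumes L: "lipschitz_coords I L g" and "finite I"
  shows "g \<in> borel_measurable (PiM I (\<lambda>_. borel))"
proof -
  have "continuous_on UNIV g"
    unfolding continuous_on_def
  proof (intro ballI)
    fix x :: "'i \<Rightarrow> real"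
    have "((\<lambda>y. L * L2_set (\<lambda>i. y i - x i) I) \<longlongrightarrow> L * L2_set (\<lambda>i. x i - x i) I) (at x)"
      unfolding L2_set_def
      by (intro tendsto_intros isCont_tendsto_compose[of _ "\<lambda>y. y _"] continuous_on_interior[of UNIV]
          tendsto_within_subset[OF continuous_on_product_coordinates[unfolded continuous_on_def, rule_format]]) auto
    then have "((\<lambda>y. L * L2_set (\<lambda>i. y i - x i) I) \<longlongrightarrow> 0) (at x)" by (simp add: L2_set_def)
    moreover have "\<forall>\<^sub>F y in at x. norm (g y - g x) \<le> L * L2_set (\<lambda>i. y i - x i) I"
      using L unfolding lipschitz_coords_def by simp
    ultimately have "((\<lambda>y. g y - g x) \<longlongrightarrow> 0) (at x)" by (rule Lim_null_comparison[rotated])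
    then show "(g \<longlongrightarrow> g x) (at x within UNIV)" by (simp add: LIM_zero_iff)
  qed
  then have "g \<in> borel_measurable borel" by (rule borel_measurable_continuous_onI)
  then have g: "g \<in> borel_measurable (PiM UNIV (\<lambda>_. borel))"
    by (subst measurable_cong_sets[OF sets_PiM_equal_borel refl])
  have "(\<lambda>x i. if i \<in> I then x i else 0) \<in> PiM I (\<lambda>_. borel) \<rightarrow>\<^sub>M PiM UNIV (\<lambda>_. borel :: real measure)"
  proof (rule measurable_PiM_single')
    show "(\<lambda>x. if i \<in> I then x i else 0) \<in> borel_measurable (PiM I (\<lambda>_. borel :: real measure))" for i
      by (cases "i \<in> I") auto
  qed (auto simp: space_PiM)
  from measurable_compose[OF this g] show ?thesis
    by (rule measurable_cong[THEN iffD1, rotated]) (rule lipschitz_coords_cong[OF L], simp)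
qed

section \<open>Exponential integrals of infimum convolutions\<close>

text \<open>Up to second order \<open>exp d + exp (- d)\<close> exceeds \<open>2\<close> by \<open>d\<^sup>2\<close>. The weight \<open>\<theta>\<close> minimises the first
exponent over the unit interval, which lowers it from \<open>d\<close> to \<open>d - 2 * d\<^sup>2\<close> for small \<open>d\<close>, and this
saving pays for the excess.\<close>

lemma exp_pair_bound:
  assumes "0 \<le> (d::real)"
  defines "\<theta> \<equiv> min 1 (4 * d)"
  shows "exp ((1 - \<theta>) * d + \<theta>\<^sup>2 / 8) + exp (- d) \<le> 2"
proof -
  have small: "exp (d - 2 * d\<^sup>2) + exp (- d) \<le> 2" if d: "0 \<le> d" "4 * d \<le> 1" for d :: real
  proof -
    have x: "0 \<le> d - 2 * d\<^sup>2" "d - 2 * d\<^sup>2 \<le> d"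
      using d mult_left_mono[of "2 * d" 1 d] by (auto simp: power2_eq_square)
    have "exp (d - 2 * d\<^sup>2) \<le> 1 + (d - 2 * d\<^sup>2) + (d - 2 * d\<^sup>2)\<^sup>2"
      using x d by (intro exp_bound) linarith+
    also have "(d - 2 * d\<^sup>2)\<^sup>2 \<le> d\<^sup>2" using x by (intro power_mono) auto
    finally have 1: "exp (d - 2 * d\<^sup>2) \<le> 1 + d - d\<^sup>2" by simp
    have "exp (- d) \<le> 1 / (1 + d)"
      using d exp_ge_add_one_self[of d] by (simp add: exp_minus field_simps)
    also have "\<dots> \<le> 1 - d + d\<^sup>2"
      using d by (simp add: field_simps power2_eq_square)
    finally show ?thesis using 1 by simp
  qed
  show ?thesis
  proof (cases "4 * d \<le> 1")
    case True
    then have "(1 - \<theta>) * d + \<theta>\<^sup>2 / 8 = d - 2 * d\<^sup>2"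
      by (simp add: \<theta>_def power2_eq_square algebra_simps)
    with small[of d] True assms(1) show ?thesis by simp
  next
    case False
    have "exp (1 / 8 :: real) + exp (- (1 / 4)) \<le> 2"
      using small[of "1/4"] by (simp add: power2_eq_square)
    moreover have "exp (- d) \<le> exp (- (1 / 4))" using False by simp
    moreover have "exp ((1 - \<theta>) * d + \<theta>\<^sup>2 / 8) = exp (1 / 8)" using False by (simp add: \<theta>_def)
    ultimately show ?thesis by linarith
  qed
qed

text \<open>The one-dimensional core. From the point with the larger value of \<open>h\<close> one moves a fraction \<open>\<theta>\<close> of
the way towards the other one, whose distance is at most \<open>2 * a\<close>: by convexity this lowers \<open>h\<close> by
\<open>\<theta> * d\<close>, where \<open>d\<close> is the difference of the two values, at a cost of at most \<open>\<theta>\<^sup>2 / 8\<close>. The point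
with the smaller value stays where it is.\<close>

lemma symmetrized_pair_bound:
  fixes h :: "real \<Rightarrow> real"
  assumes h: "convex_on UNIV h" and a: "a > 0" "\<bar>s\<bar> \<le> a" "\<bar>s'\<bar> \<le> a"
  shows "\<exists>v w. exp (h v + (s - v)\<^sup>2 / (32 * a\<^sup>2) - h s') + exp (h w + (s' - w)\<^sup>2 / (32 * a\<^sup>2) - h s) \<le> 2"
proof -
  have *: "\<exists>v w. exp (h v + (s - v)\<^sup>2 / (32 * a\<^sup>2) - h s') + exp (h w + (s' - w)\<^sup>2 / (32 * a\<^sup>2) - h s) \<le> 2"
    if s: "\<bar>s\<bar> \<le> a" "\<bar>s'\<bar> \<le> a" and le: "h s' \<le> h s" for s s'
  proof -
    define d where "d = h s - h s'"
    define \<theta> where "\<theta> = min 1 (4 * d)"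
    define v where "v = (1 - \<theta>) * s + \<theta> * s'"
    have d: "0 \<le> d" using le by (simp add: d_def)
    then have \<theta>: "0 \<le> \<theta>" "\<theta> \<le> 1" by (auto simp: \<theta>_def)
    have "h v \<le> (1 - \<theta>) * h s + \<theta> * h s'"
      unfolding v_def using convex_onD[OF h \<theta>, of s s'] by simp
    moreover have "(s - v)\<^sup>2 / (32 * a\<^sup>2) \<le> \<theta>\<^sup>2 / 8"
    proof -
      have "(s - v)\<^sup>2 = \<theta>\<^sup>2 * (s - s')\<^sup>2" by (simp add: v_def power2_eq_square algebra_simps)
      also have "(s - s')\<^sup>2 \<le> (2 * a)\<^sup>2" using s by (intro power2_le_iff_abs_le[THEN iffD2]) auto
      then have "\<theta>\<^sup>2 * (s - s')\<^sup>2 \<le> \<theta>\<^sup>2 * (2 * a)\<^sup>2" by (intro mult_left_mono) auto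
      finally have "(s - v)\<^sup>2 / (32 * a\<^sup>2) \<le> \<theta>\<^sup>2 * (2 * a)\<^sup>2 / (32 * a\<^sup>2)" by (intro divide_right_mono) auto
      also have "\<dots> = \<theta>\<^sup>2 / 8" using a by (simp add: power2_eq_square)
      finally show ?thesis .
    qed
    ultimately have "h v + (s - v)\<^sup>2 / (32 * a\<^sup>2) - h s' \<le> (1 - \<theta>) * d + \<theta>\<^sup>2 / 8"
      by (simp add: d_def algebra_simps)
    then have "exp (h v + (s - v)\<^sup>2 / (32 * a\<^sup>2) - h s') \<le> exp ((1 - \<theta>) * d + \<theta>\<^sup>2 / 8)" by simp
    moreover have "exp (h s' + (s' - s')\<^sup>2 / (32 * a\<^sup>2) - h s) = exp (- d)" by (simp add: d_def)
    ultimately show ?thesis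
      using exp_pair_bound[OF d] unfolding \<theta>_def by (intro exI[of _ v] exI[of _ s']) linarith
  qed
  show ?thesis
  proof (cases "h s' \<le> h s")
    case True then show ?thesis using *[of s s'] a by simp
  next
    case False
    then obtain v w where "exp (h v + (s' - v)\<^sup>2 / (32 * a\<^sup>2) - h s) + exp (h w + (s - w)\<^sup>2 / (32 * a\<^sup>2) - h s') \<le> 2"
      using *[of s' s] a by auto
    then show ?thesis by (intro exI[of _ w] exI[of _ v]) simp
  qed
qed

lemma (in prob_space) nn_integral_exp_pos:
  assumes "g \<in> borel_measurable M"
  shows "(\<integral>\<^sup>+x. ennreal (exp (g x)) \<partial>M) \<noteq> 0"
proof
  assume "(\<integral>\<^sup>+x. ennreal (exp (g x)) \<partial>M) = 0"
  then have "AE x in M. ennreal (exp (g x)) = 0"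
    using assms by (subst (asm) nn_integral_0_iff_AE) auto
  then show False by (auto simp: ennreal_eq_0_iff)
qed

text \<open>This is Hoelder's inequality. Dividing the two exponentials by their integrals \<open>exp (h s)\<close> and
\<open>exp (h s')\<close> reduces it to the convexity of \<open>exp\<close>.\<close>

lemma (in prob_space) log_integral_exp_convex:
  fixes G :: "real \<Rightarrow> 'a \<Rightarrow> real" and h :: "real \<Rightarrow> real"
  assumes G: "\<And>s. G s \<in> borel_measurable M"
    and conv: "\<And>x. convex_on UNIV (\<lambda>s. G s x)"
    and h: "\<And>s. (\<integral>\<^sup>+x. ennreal (exp (G s x)) \<partial>M) = ennreal (exp (h s))"
  shows "convex_on UNIV h"
proof (rule convex_onI)
  fix u s s' :: real assume u: "0 < u" "u < 1"
  define E where "E = exp ((1 - u) * h s + u * h s')"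
  have pt: "exp (G ((1 - u) * s + u * s') x)
      \<le> E * (1 - u) * exp (- h s) * exp (G s x) + E * u * exp (- h s') * exp (G s' x)" for x
  proof -
    have "G ((1 - u) * s + u * s') x \<le> (1 - u) * G s x + u * G s' x"
      using convex_onD[OF conv[of x], of u s s'] u by simp
    also have "\<dots> = ((1 - u) * h s + u * h s') + ((1 - u) * (G s x - h s) + u * (G s' x - h s'))"
      by (simp add: algebra_simps)
    finally have "exp (G ((1 - u) * s + u * s') x) \<le> E * exp ((1 - u) * (G s x - h s) + u * (G s' x - h s'))"
      by (simp add: E_def exp_add[symmetric])
    also have "exp ((1 - u) * (G s x - h s) + u * (G s' x - h s'))
        \<le> (1 - u) * exp (G s x - h s) + u * exp (G s' x - h s')"
      using convex_onD[OF exp_convex, of u "G s x - h s" "G s' x - h s'"] u by simp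
    finally show ?thesis
      by (simp add: E_def algebra_simps exp_diff exp_minus divide_inverse)
  qed
  have "ennreal (exp (h ((1 - u) * s + u * s'))) = (\<integral>\<^sup>+x. ennreal (exp (G ((1 - u) * s + u * s') x)) \<partial>M)"
    by (simp add: h)
  also have "\<dots> \<le> (\<integral>\<^sup>+x. ennreal (E * (1 - u) * exp (- h s)) * ennreal (exp (G s x))
       + ennreal (E * u * exp (- h s')) * ennreal (exp (G s' x)) \<partial>M)"
    using pt u by (intro nn_integral_mono) (auto simp: E_def ennreal_mult[symmetric] ennreal_plus[symmetric]
        simp del: ennreal_plus intro!: ennreal_leI)
  also have "\<dots> = ennreal (E * (1 - u) * exp (- h s)) * ennreal (exp (h s))
       + ennreal (E * u * exp (- h s')) * ennreal (exp (h s'))"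
    using G by (simp add: nn_integral_add nn_integral_cmult h)
  also have "\<dots> = ennreal (E * (1 - u) * exp (- h s) * exp (h s) + E * u * exp (- h s') * exp (h s'))"
    using u by (simp add: E_def ennreal_mult[symmetric] ennreal_plus[symmetric] del: ennreal_plus)
  also have "E * (1 - u) * exp (- h s) * exp (h s) + E * u * exp (- h s') * exp (h s') = E"
    by (simp add: exp_minus algebra_simps)
  finally have "exp (h ((1 - u) * s + u * s')) \<le> E" by (simp add: E_def)
  then show "h ((1 - u) *\<^sub>R s + u *\<^sub>R s') \<le> (1 - u) * h s + u * h s'" by (simp add: E_def)
qed auto

text \<open>Twice the product of the integrals is the double integral of the symmetrised product.\<close>

lemma (in prob_space) nn_integral_product_le_1_if_symmetrized:
  assumes meas [measurable]: "A \<in> borel_measurable M" "B \<in> borel_measurable M"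
    and AE: "AE s in M. P s"
    and le: "\<And>s s'. P s \<Longrightarrow> P s' \<Longrightarrow> A s * B s' + A s' * B s \<le> (2 :: ennreal)"
  shows "(\<integral>\<^sup>+s. A s \<partial>M) * (\<integral>\<^sup>+s. B s \<partial>M) \<le> 1"
proof -
  let ?A = "\<integral>\<^sup>+s. A s \<partial>M" and ?B = "\<integral>\<^sup>+s. B s \<partial>M"
  have "?A * ?B + ?A * ?B = (\<integral>\<^sup>+s. (A s * ?B + ?A * B s) \<partial>M)"
    by (simp add: nn_integral_add nn_integral_cmult nn_integral_multc)
  also have "\<dots> = (\<integral>\<^sup>+s. (\<integral>\<^sup>+s'. (A s * B s' + A s' * B s) \<partial>M) \<partial>M)"
    by (simp add: nn_integral_add nn_integral_cmult nn_integral_multc)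
  also have "\<dots> \<le> (\<integral>\<^sup>+s. (\<integral>\<^sup>+s'. 2 \<partial>M) \<partial>M)"
  proof (intro nn_integral_mono_AE)
    show "AE s in M. (\<integral>\<^sup>+s'. (A s * B s' + A s' * B s) \<partial>M) \<le> (\<integral>\<^sup>+s'. 2 \<partial>M)"
      using AE
    proof eventually_elim
      fix s assume "P s"
      then show "(\<integral>\<^sup>+s'. (A s * B s' + A s' * B s) \<partial>M) \<le> (\<integral>\<^sup>+s'. 2 \<partial>M)"
        using AE le by (intro nn_integral_mono_AE) (auto elim!: eventually_mono)
    qed
  qed
  also have "\<dots> = 2" by (simp add: emeasure_space_1)
  finally have "2 * (?A * ?B) \<le> 2 * 1" by (simp add: mult_2)
  then show ?thesis by (subst (asm) ennreal_mult_le_mult_iff) auto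
qed

text \<open>Maurey's inequality for convex functions under product measures on a cube, by induction on the number
of coordinates. Fix the new coordinate \<open>s\<close> and let \<open>h s\<close> be the logarithm of the integral of
\<open>exp (inf_conv \<kappa> I (g s))\<close>. The induction hypothesis bounds the integral of \<open>exp (- g s)\<close> by
\<open>exp (- h s)\<close>, and the additivity of the cost bounds the integral of the exponential of the full
infimum convolution by \<open>exp (h s' + (s - s')\<^sup>2 / \<kappa>)\<close> for every \<open>s'\<close>. What is left is the
one-dimensional inequality for \<open>h\<close>, and that needs \<open>h\<close> to be convex. The function obtained in the same
way from \<open>exp (- g s)\<close> would in general not be convex, which is why \<open>h\<close> is built from the infimum convolution.\<close>

theorem inf_conv_exp_integral:
  fixes M :: "'i::countable \<Rightarrow> real measure"
  assumes "finite I" and prob: "\<And>i. prob_space (M i)" and sets: "\<And>i. sets (M i) = sets borel"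
    and bd: "\<And>i. AE s in M i. \<bar>s\<bar> \<le> a" and a: "a > 0"
    and "lipschitz_coords I L g" "convex_coords g"
  shows "(\<integral>\<^sup>+x. ennreal (exp (inf_conv (32 * a\<^sup>2) I g x)) \<partial>PiM I M) * (\<integral>\<^sup>+x. ennreal (exp (- g x)) \<partial>PiM I M) \<le> 1"
proof -
  interpret product_sigma_finite M
    by (rule product_sigma_finite.intro) (rule prob_space_imp_sigma_finite[OF prob])
  show ?thesis
    using \<open>finite I\<close> \<open>lipschitz_coords I L g\<close> \<open>convex_coords g\<close>
  proof (induction I arbitrary: g rule: finite_induct)
    case empty
    have k: "32 * a\<^sup>2 > 0" using a by simp
    have "inf_conv (32 * a\<^sup>2) {} g x \<le> g x" for x
      using inf_conv_le[OF empty.prems(1) k, of x x] by simp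
    then have "exp (inf_conv (32 * a\<^sup>2) {} g x) * exp (- g x) \<le> 1" for x
      by (simp add: exp_add[symmetric])
    then show ?case
      by (simp add: nn_integral_empty ennreal_mult[symmetric])
  next
    case (insert k I)
    define \<kappa> where "\<kappa> = 32 * a\<^sup>2"
    have \<kappa>: "\<kappa> > 0" using a by (simp add: \<kappa>_def)
    interpret P: prob_space "PiM I M" by (rule prob_space_PiM[OF prob])
    interpret K: prob_space "M k" by (rule prob)
    have setsP: "sets (PiM J M) = sets (PiM J (\<lambda>_. borel))" for J
      by (rule sets_PiM_cong) (auto simp: sets)
    have lip_meas: "f \<in> borel_measurable (PiM J M)" if "lipschitz_coords J L f" "finite J" for f J
      using borel_measurable_lipschitz_coords[OF that] by (subst measurable_cong_sets[OF setsP refl])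
    note L = insert.prems(1) insert.hyps(2,1)
    note Ls = lipschitz_section[OF L]
    define G where "G = (\<lambda>s x. inf_conv \<kappa> I (\<lambda>x. g (x(k := s))) x)"
    define A where "A = (\<lambda>s. \<integral>\<^sup>+x. ennreal (exp (inf_conv \<kappa> (insert k I) g (x(k := s)))) \<partial>PiM I M)"
    define B where "B = (\<lambda>s. \<integral>\<^sup>+x. ennreal (exp (- g (x(k := s)))) \<partial>PiM I M)"
    define H where "H = (\<lambda>s. \<integral>\<^sup>+x. ennreal (exp (G s x)) \<partial>PiM I M)"
    define h where "h = (\<lambda>s. ln (enn2real (H s)))"
    have G_meas: "G s \<in> borel_measurable (PiM I M)" for s
      unfolding G_def by (intro lip_meas lipschitz_inf_conv Ls \<kappa> insert.hyps)
    have HB: "H s * B s \<le> 1" for s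
      unfolding H_def B_def G_def \<kappa>_def by (rule insert.IH[OF Ls convex_section[OF insert.prems(2)]])
    \<comment> \<open>As \<open>B\<close> is positive, \<open>HB\<close> makes \<open>H\<close> finite.\<close>
    have "B s \<noteq> 0" for s
      unfolding B_def by (intro P.nn_integral_exp_pos borel_measurable_uminus lip_meas Ls insert.hyps)
    then have H_top: "H s \<noteq> \<top>" for s using HB[of s] by (auto simp: ennreal_top_mult top_unique)
    have H_0: "H s \<noteq> 0" for s
      unfolding H_def by (intro P.nn_integral_exp_pos G_meas)
    have H: "H s = ennreal (exp (h s))" for s
    proof -
      obtain r where r: "H s = ennreal r" "0 \<le> r" using H_top[of s] by (cases "H s") auto
      with H_0[of s] have "r > 0" by (cases "r = 0") auto
      with r show ?thesis by (simp add: h_def)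
    qed
    have h_convex: "convex_on UNIV h"
    proof (rule P.log_integral_exp_convex)
      show "convex_on UNIV (\<lambda>s. G s x)" for x
        unfolding G_def using inf_conv_section_convex[OF L insert.prems(2) \<kappa>] 
        by (intro convex_onI) (simp_all del: fun_upd_apply)
      show "(\<integral>\<^sup>+x. ennreal (exp (G s x)) \<partial>PiM I M) = ennreal (exp (h s))" for s
        using H by (simp add: H_def)
    qed (rule G_meas)
    have A_le: "A s \<le> ennreal (exp (h s' + (s - s')\<^sup>2 / \<kappa>))" for s s'
    proof -
      have "A s \<le> (\<integral>\<^sup>+x. ennreal (exp ((s - s')\<^sup>2 / \<kappa>)) * ennreal (exp (G s' x)) \<partial>PiM I M)"
        unfolding A_def G_def using inf_conv_insert_le[OF L \<kappa>]
        by (intro nn_integral_mono) (simp add: ennreal_mult[symmetric] exp_add[symmetric] add.commute del: fun_upd_apply)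
      also have "\<dots> = ennreal (exp ((s - s')\<^sup>2 / \<kappa>)) * H s'"
        using G_meas by (simp add: nn_integral_cmult H_def)
      finally show ?thesis by (simp add: H ennreal_mult[symmetric] exp_add[symmetric] add.commute)
    qed
    have B_le: "B s \<le> ennreal (exp (- h s))" for s
    proof -
      have "B s = ennreal (exp (- h s)) * (H s * B s)"
        by (simp add: H mult.assoc[symmetric] ennreal_mult[symmetric] exp_add[symmetric])
      also have "\<dots> \<le> ennreal (exp (- h s)) * 1" by (intro mult_left_mono HB) auto
      finally show ?thesis by simp
    qed
    have meas_upd: "(\<lambda>s. \<integral>\<^sup>+x. ennreal (exp (f (x(k := s)))) \<partial>PiM I M) \<in> borel_measurable (M k)"
      if f: "f \<in> borel_measurable (PiM (insert k I) M)" for f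
    proof (rule P.borel_measurable_nn_integral)
      have "(\<lambda>(s, x). x(k := s)) \<in> M k \<Otimes>\<^sub>M PiM I M \<rightarrow>\<^sub>M PiM (insert k I) M"
        using insert.hyps by measurable
      from measurable_compose[OF this f]
      show "(\<lambda>(s, x). ennreal (exp (f (x(k := s))))) \<in> borel_measurable (M k \<Otimes>\<^sub>M PiM I M)"
        by (simp add: case_prod_beta)
    qed
    have g_meas: "g \<in> borel_measurable (PiM (insert k I) M)"
      using insert by (intro lip_meas) auto
    have Q_meas: "inf_conv \<kappa> (insert k I) g \<in> borel_measurable (PiM (insert k I) M)"
      using insert \<kappa> by (intro lip_meas lipschitz_inf_conv) auto
    have "(\<integral>\<^sup>+s. A s \<partial>M k) * (\<integral>\<^sup>+s. B s \<partial>M k) \<le> 1"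
    proof (rule K.nn_integral_product_le_1_if_symmetrized[OF _ _ bd])
      fix s s' :: real assume "\<bar>s\<bar> \<le> a" "\<bar>s'\<bar> \<le> a"
      from symmetrized_pair_bound[OF h_convex a this] obtain v w
        where vw: "exp (h v + (s - v)\<^sup>2 / \<kappa> - h s') + exp (h w + (s' - w)\<^sup>2 / \<kappa> - h s) \<le> 2"
        unfolding \<kappa>_def by blast
      have AB: "A s * B s' \<le> ennreal (exp (h v + (s - v)\<^sup>2 / \<kappa> - h s'))" for s s' v
        using mult_mono[OF A_le[of s v] B_le[of s']] by (simp add: ennreal_mult[symmetric] exp_add[symmetric])
      have "A s * B s' + A s' * B s
          \<le> ennreal (exp (h v + (s - v)\<^sup>2 / \<kappa> - h s')) + ennreal (exp (h w + (s' - w)\<^sup>2 / \<kappa> - h s))"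
        by (intro add_mono AB)
      also have "\<dots> \<le> ennreal 2" using ennreal_leI[OF vw] by simp
      finally show "A s * B s' + A s' * B s \<le> 2" by simp
    qed (use meas_upd[OF borel_measurable_uminus[OF g_meas]] meas_upd[OF Q_meas] in \<open>simp_all add: A_def B_def\<close>)
    also have "(\<integral>\<^sup>+s. A s \<partial>M k) = (\<integral>\<^sup>+x. ennreal (exp (inf_conv \<kappa> (insert k I) g x)) \<partial>PiM (insert k I) M)"
      unfolding A_def using insert.hyps Q_meas by (subst product_nn_integral_insert_rev) auto
    also have "(\<integral>\<^sup>+s. B s \<partial>M k) = (\<integral>\<^sup>+x. ennreal (exp (- g x)) \<partial>PiM (insert k I) M)"
      unfolding B_def using insert.hyps g_meas by (subst product_nn_integral_insert_rev) auto
    finally show ?case unfolding \<kappa>_def .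
  qed
qed

section \<open>Concentration for bounded variables\<close>

lemma borel_measurable_lipschitz_compose:
  fixes X :: "'i::countable \<Rightarrow> 'a \<Rightarrow> real"
  assumes L: "lipschitz_coords I L f" and "finite I" and X: "\<And>i. i \<in> I \<Longrightarrow> X i \<in> borel_measurable M"
  shows "(\<lambda>\<omega>. f (\<lambda>i. X i \<omega>)) \<in> borel_measurable M"
proof -
  have "(\<lambda>\<omega>. \<lambda>i\<in>I. X i \<omega>) \<in> M \<rightarrow>\<^sub>M PiM I (\<lambda>_. borel)"
    by (rule measurable_restrict) (rule X)
  from measurable_compose[OF this borel_measurable_lipschitz_coords[OF L \<open>finite I\<close>]]
  have "(\<lambda>\<omega>. f (\<lambda>i\<in>I. X i \<omega>)) \<in> borel_measurable M" .
  moreover have "f (\<lambda>i\<in>I. X i \<omega>) = f (\<lambda>i. X i \<omega>)" for \<omega>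
    by (rule lipschitz_coords_cong[OF L]) simp
  ultimately show ?thesis by simp
qed

lemma lipschitz_coords_scale:
  assumes "lipschitz_coords I L f" "l \<ge> 0"
  shows "lipschitz_coords I (l * L) (\<lambda>x. l * f x)"
  unfolding lipschitz_coords_def
proof (intro allI)
  fix x y
  have "\<bar>l * f x - l * f y\<bar> = l * \<bar>f x - f y\<bar>"
    using assms(2) by (simp add: abs_mult flip: right_diff_distrib)
  also have "\<dots> \<le> l * (L * L2_set (\<lambda>i. x i - y i) I)"
    using assms unfolding lipschitz_coords_def by (intro mult_left_mono) auto
  finally show "\<bar>l * f x - l * f y\<bar> \<le> l * L * L2_set (\<lambda>i. x i - y i) I" by (simp add: mult.assoc)
qed

lemma convex_coords_scale:
  assumes "convex_coords f" "l \<ge> 0"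
  shows "convex_coords (\<lambda>x. l * f x)"
  unfolding convex_coords_def
proof (intro allI ballI)
  fix x y and u :: real assume "u \<in> {0..1}"
  then have "f (\<lambda>i. (1 - u) * x i + u * y i) \<le> (1 - u) * f x + u * f y"
    using assms(1) unfolding convex_coords_def by blast
  then have "l * f (\<lambda>i. (1 - u) * x i + u * y i) \<le> l * ((1 - u) * f x + u * f y)"
    using assms(2) by (intro mult_left_mono) auto
  then show "l * f (\<lambda>i. (1 - u) * x i + u * y i) \<le> (1 - u) * (l * f x) + u * (l * f y)"
    by (simp add: algebra_simps)
qed

text \<open>The infimum convolution of an \<open>L\<close>-Lipschitz function differs from it by at most \<open>\<kappa> * L\<^sup>2 / 4\<close>, which
is \<open>8 * a\<^sup>2 * L\<^sup>2\<close> for the cost constant \<open>\<kappa> = 32 * a\<^sup>2\<close>.\<close>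

lemma (in prob_space) expectation_exp_product_le:
  fixes Y :: "'i::countable \<Rightarrow> 'a \<Rightarrow> real"
  assumes indep: "indep_vars (\<lambda>_. borel) Y I" and I: "finite I" "I \<noteq> {}"
    and bd: "\<And>i \<omega>. i \<in> I \<Longrightarrow> \<omega> \<in> space M \<Longrightarrow> \<bar>Y i \<omega>\<bar> \<le> a" and a: "a > 0"
    and L: "lipschitz_coords I L f" and c: "convex_coords f"
  shows "(\<integral>\<^sup>+\<omega>. ennreal (exp (f (\<lambda>i. Y i \<omega>))) \<partial>M) * (\<integral>\<^sup>+\<omega>. ennreal (exp (- f (\<lambda>i. Y i \<omega>))) \<partial>M)
    \<le> ennreal (exp (8 * a\<^sup>2 * L\<^sup>2))"
proof -
  define D where "D = (\<lambda>i. distr M borel (if i \<in> I then Y i else (\<lambda>_. 0)))"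
  have rv [measurable]: "i \<in> I \<Longrightarrow> Y i \<in> borel_measurable M" for i
    using indep by (auto simp: indep_vars_def)
  then have rv': "(if i \<in> I then Y i else (\<lambda>_. 0)) \<in> borel_measurable M" for i by auto
  have D_prob: "prob_space (D i)" for i
    unfolding D_def by (rule prob_space_distr[OF rv'])
  have D_sets: "sets (D i) = sets borel" for i by (simp add: D_def)
  have D_bd: "AE s in D i. \<bar>s\<bar> \<le> a" for i
  proof -
    have "AE \<omega> in M. \<bar>(if i \<in> I then Y i else (\<lambda>_. 0)) \<omega>\<bar> \<le> a"
      using bd a by (intro AE_I2) auto
    then show ?thesis unfolding D_def by (subst AE_distr_iff[OF rv']) auto
  qed
  have law: "distr M (PiM I (\<lambda>_. borel)) (\<lambda>\<omega>. \<lambda>i\<in>I. Y i \<omega>) = PiM I D"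
  proof -
    have "distr M (PiM I (\<lambda>_. borel)) (\<lambda>\<omega>. \<lambda>i\<in>I. Y i \<omega>) = PiM I (\<lambda>i. distr M borel (Y i))"
      using indep_vars_iff_distr_eq_PiM'[where I = I and M' = "\<lambda>_. borel" and X = Y] I(2) rv indep by simp
    also have "\<dots> = PiM I D" by (rule PiM_cong) (simp_all add: D_def)
    finally show ?thesis .
  qed
  have push: "(\<integral>\<^sup>+x. ennreal (exp (h x)) \<partial>PiM I D) = (\<integral>\<^sup>+\<omega>. ennreal (exp (h (\<lambda>i. Y i \<omega>))) \<partial>M)"
    if h: "lipschitz_coords I L' h" for h L'
  proof -
    have m: "h \<in> borel_measurable (PiM I (\<lambda>_. borel))"
      by (rule borel_measurable_lipschitz_coords[OF h I(1)])
    have "h (\<lambda>i\<in>I. Y i \<omega>) = h (\<lambda>i. Y i \<omega>)" for \<omega>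
      by (rule lipschitz_coords_cong[OF h]) simp
    then show ?thesis
      unfolding law[symmetric] using m by (subst nn_integral_distr) (auto intro!: measurable_restrict rv)
  qed
  have L': "lipschitz_coords I L (\<lambda>x. - f x)"
    using L unfolding lipschitz_coords_def by (simp add: abs_minus_commute)
  have a2: "32 * a\<^sup>2 > 0" using a by simp
  define E where "E = ennreal (exp (8 * a\<^sup>2 * L\<^sup>2))"
  have "exp (f x) \<le> exp (8 * a\<^sup>2 * L\<^sup>2) * exp (inf_conv (32 * a\<^sup>2) I f x)" for x
    using inf_conv_ge_lipschitz[OF L a2, of x] by (simp add: exp_add[symmetric] algebra_simps)
  then have "(\<integral>\<^sup>+x. ennreal (exp (f x)) \<partial>PiM I D)
      \<le> (\<integral>\<^sup>+x. E * ennreal (exp (inf_conv (32 * a\<^sup>2) I f x)) \<partial>PiM I D)"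
    by (intro nn_integral_mono) (simp add: E_def ennreal_mult[symmetric])
  also have "\<dots> = E * (\<integral>\<^sup>+x. ennreal (exp (inf_conv (32 * a\<^sup>2) I f x)) \<partial>PiM I D)"
  proof (rule nn_integral_cmult)
    have "sets (PiM I D) = sets (PiM I (\<lambda>_. borel))" by (rule sets_PiM_cong) (auto simp: D_sets)
    with borel_measurable_lipschitz_coords[OF lipschitz_inf_conv[OF L a2] I(1)]
    have "inf_conv (32 * a\<^sup>2) I f \<in> borel_measurable (PiM I D)"
      using measurable_cong_sets by blast
    then show "(\<lambda>x. ennreal (exp (inf_conv (32 * a\<^sup>2) I f x))) \<in> borel_measurable (PiM I D)" by simp
  qed
  finally have "(\<integral>\<^sup>+x. ennreal (exp (f x)) \<partial>PiM I D) * (\<integral>\<^sup>+x. ennreal (exp (- f x)) \<partial>PiM I D)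
      \<le> E * (\<integral>\<^sup>+x. ennreal (exp (inf_conv (32 * a\<^sup>2) I f x)) \<partial>PiM I D) * (\<integral>\<^sup>+x. ennreal (exp (- f x)) \<partial>PiM I D)"
    by (rule mult_right_mono) simp
  also have "\<dots> \<le> E * 1"
    unfolding mult.assoc
    by (intro mult_left_mono inf_conv_exp_integral[OF I(1) D_prob D_sets D_bd a L c]) auto
  finally show ?thesis
    by (simp add: push[OF L] push[OF L'] E_def)
qed

text \<open>Centring \<open>F\<close> does not change the product, and by Jensen's inequality each of the two centred
factors is at least \<open>1\<close>. So the bound holds for both of them, and upper and lower tails are obtained at
once although convexity is not symmetric.\<close>

lemma (in prob_space) exp_moment_if_product_le:
  assumes int: "integrable M F" and le: "(\<integral>\<^sup>+\<omega>. ennreal (exp (F \<omega>)) \<partial>M) * (\<integral>\<^sup>+\<omega>. ennreal (exp (- F \<omega>)) \<partial>M) \<le> ennreal c"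
  shows "(\<integral>\<^sup>+\<omega>. ennreal (exp (F \<omega> - expectation F)) \<partial>M) \<le> ennreal c"
    and "(\<integral>\<^sup>+\<omega>. ennreal (exp (expectation F - F \<omega>)) \<partial>M) \<le> ennreal c"
proof -
  have [measurable]: "F \<in> borel_measurable M" using int by auto
  have jensen: "1 \<le> (\<integral>\<^sup>+\<omega>. ennreal (exp (G \<omega> - expectation G)) \<partial>M)" if G: "integrable M G" for G
  proof -
    have "1 = ennreal (\<integral>\<omega>. 1 + (G \<omega> - expectation G) \<partial>M)"
      using G by (simp add: prob_space)
    also have "\<dots> \<le> (\<integral>\<^sup>+\<omega>. ennreal (1 + (G \<omega> - expectation G)) \<partial>M)"
    proof -
      have i: "integrable M (\<lambda>\<omega>. 1 + (G \<omega> - expectation G))" using G by simp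
      have "ennreal (\<integral>\<omega>. 1 + (G \<omega> - expectation G) \<partial>M)
          \<le> ennreal (\<integral>\<omega>. max 0 (1 + (G \<omega> - expectation G)) \<partial>M)"
        using i by (intro ennreal_leI integral_mono) auto
      also have "\<dots> = (\<integral>\<^sup>+\<omega>. ennreal (max 0 (1 + (G \<omega> - expectation G))) \<partial>M)"
        using i by (intro nn_integral_eq_integral[symmetric]) auto
      finally show ?thesis by (simp only: ennreal_max_0)
    qed
    also have "\<dots> \<le> (\<integral>\<^sup>+\<omega>. ennreal (exp (G \<omega> - expectation G)) \<partial>M)"
      by (intro nn_integral_mono ennreal_leI) simp
    finally show ?thesis .
  qed
  let ?m = "expectation F"
  have split: "(\<integral>\<^sup>+\<omega>. ennreal (exp (F \<omega> - ?m)) \<partial>M) = ennreal (exp (- ?m)) * (\<integral>\<^sup>+\<omega>. ennreal (exp (F \<omega>)) \<partial>M)"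
    "(\<integral>\<^sup>+\<omega>. ennreal (exp (?m - F \<omega>)) \<partial>M) = ennreal (exp ?m) * (\<integral>\<^sup>+\<omega>. ennreal (exp (- F \<omega>)) \<partial>M)"
    by (subst nn_integral_cmult[symmetric]; simp add: ennreal_mult[symmetric] exp_add[symmetric])+
  have unit: "ennreal (exp (- ?m)) * ennreal (exp ?m) = 1"
    by (simp add: ennreal_mult[symmetric] exp_add[symmetric])
  have "(\<integral>\<^sup>+\<omega>. ennreal (exp (F \<omega> - ?m)) \<partial>M) * (\<integral>\<^sup>+\<omega>. ennreal (exp (?m - F \<omega>)) \<partial>M)
     = (ennreal (exp (- ?m)) * ennreal (exp ?m)) * ((\<integral>\<^sup>+\<omega>. ennreal (exp (F \<omega>)) \<partial>M) * (\<integral>\<^sup>+\<omega>. ennreal (exp (- F \<omega>)) \<partial>M))"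
    unfolding split by (simp only: mult_ac)
  then have prod: "(\<integral>\<^sup>+\<omega>. ennreal (exp (F \<omega> - ?m)) \<partial>M) * (\<integral>\<^sup>+\<omega>. ennreal (exp (?m - F \<omega>)) \<partial>M) \<le> ennreal c"
    using le unit by simp
  have 1: "1 \<le> (\<integral>\<^sup>+\<omega>. ennreal (exp (F \<omega> - ?m)) \<partial>M)" by (rule jensen[OF int])
  have 2: "1 \<le> (\<integral>\<^sup>+\<omega>. ennreal (exp (?m - F \<omega>)) \<partial>M)"
    using jensen[of "\<lambda>\<omega>. - F \<omega>"] int by simp
  show "(\<integral>\<^sup>+\<omega>. ennreal (exp (F \<omega> - ?m)) \<partial>M) \<le> ennreal c"
    using mult_left_mono[OF 2, of "\<integral>\<^sup>+\<omega>. ennreal (exp (F \<omega> - ?m)) \<partial>M"] prod by simp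
  show "(\<integral>\<^sup>+\<omega>. ennreal (exp (?m - F \<omega>)) \<partial>M) \<le> ennreal c"
    using mult_right_mono[OF 1, of "\<integral>\<^sup>+\<omega>. ennreal (exp (?m - F \<omega>)) \<partial>M"] prod by simp
qed

lemma (in prob_space) prob_ge_le_exp_moment:
  assumes [measurable]: "G \<in> borel_measurable M"
    and le: "(\<integral>\<^sup>+\<omega>. ennreal (exp (G \<omega>)) \<partial>M) \<le> ennreal c" and c: "c \<ge> 0"
  shows "prob {\<omega> \<in> space M. G \<omega> \<ge> b} \<le> exp (- b) * c"
proof -
  have "emeasure M {\<omega> \<in> space M. G \<omega> \<ge> b} \<le> ennreal (exp (- 1 * b)) * (\<integral>\<^sup>+\<omega>. ennreal (exp (1 * G \<omega>)) * indicator (space M) \<omega> \<partial>M)"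
    by (rule Chernoff_ineq_nn_integral_ge) auto
  also have "\<dots> = ennreal (exp (- b)) * (\<integral>\<^sup>+\<omega>. ennreal (exp (G \<omega>)) \<partial>M)"
    by (auto intro!: arg_cong2[where f = "(*)"] nn_integral_cong)
  also have "\<dots> \<le> ennreal (exp (- b)) * ennreal c" by (intro mult_left_mono le) auto
  also have "\<dots> = ennreal (exp (- b) * c)" using c by (simp add: ennreal_mult)
  finally show ?thesis using c by (simp add: emeasure_eq_measure)
qed

text \<open>Chernoff's method for both tails.\<close>

theorem (in prob_space) convex_concentration_bounded:
  fixes Y :: "'i::countable \<Rightarrow> 'a \<Rightarrow> real"
  assumes indep: "indep_vars (\<lambda>_. borel) Y I" and I: "finite I" "I \<noteq> {}"
    and bd: "\<And>i \<omega>. i \<in> I \<Longrightarrow> \<omega> \<in> space M \<Longrightarrow> \<bar>Y i \<omega>\<bar> \<le> a" and a: "a > 0"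
    and L: "lipschitz_coords I 1 f" and c: "convex_coords f" and t: "t > 0"
    and int: "integrable M (\<lambda>\<omega>. f (\<lambda>i. Y i \<omega>))"
  shows "prob {\<omega> \<in> space M. \<bar>f (\<lambda>i. Y i \<omega>) - expectation (\<lambda>\<omega>. f (\<lambda>i. Y i \<omega>))\<bar> > t} \<le> 2 * exp (- t\<^sup>2 / (32 * a\<^sup>2))"
proof -
  define F where "F = (\<lambda>\<omega>. f (\<lambda>i. Y i \<omega>))"
  \<comment> \<open>The minimiser of \<open>8 * a\<^sup>2 * l\<^sup>2 - l * t\<close>.\<close>
  define l where "l = t / (16 * a\<^sup>2)"
  have l: "l > 0" using t a by (simp add: l_def)
  have int: "integrable M F" using int by (simp add: F_def)
  have [measurable]: "F \<in> borel_measurable M" using int by auto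
  have "(\<integral>\<^sup>+\<omega>. ennreal (exp (l * F \<omega>)) \<partial>M) * (\<integral>\<^sup>+\<omega>. ennreal (exp (- (l * F \<omega>))) \<partial>M)
      \<le> ennreal (exp (8 * a\<^sup>2 * (l * 1)\<^sup>2))"
    unfolding F_def
    by (rule expectation_exp_product_le[OF indep I bd a lipschitz_coords_scale[OF L] convex_coords_scale[OF c]]) (use l in auto)
  from exp_moment_if_product_le[OF _ this] int
  have m: "(\<integral>\<^sup>+\<omega>. ennreal (exp (l * F \<omega> - l * expectation F)) \<partial>M) \<le> ennreal (exp (8 * a\<^sup>2 * l\<^sup>2))"
    "(\<integral>\<^sup>+\<omega>. ennreal (exp (l * expectation F - l * F \<omega>)) \<partial>M) \<le> ennreal (exp (8 * a\<^sup>2 * l\<^sup>2))"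
    by simp_all
  have e: "exp (- (l * t)) * exp (8 * a\<^sup>2 * l\<^sup>2) = exp (- t\<^sup>2 / (32 * a\<^sup>2))"
    using a by (simp add: exp_add[symmetric] l_def power2_eq_square field_simps)
  have p: "prob {\<omega> \<in> space M. l * F \<omega> - l * expectation F \<ge> l * t} \<le> exp (- t\<^sup>2 / (32 * a\<^sup>2))"
    "prob {\<omega> \<in> space M. l * expectation F - l * F \<omega> \<ge> l * t} \<le> exp (- t\<^sup>2 / (32 * a\<^sup>2))"
    using prob_ge_le_exp_moment[OF _ m(1), of "l * t"] prob_ge_le_exp_moment[OF _ m(2), of "l * t"] e by simp_all
  have "prob {\<omega> \<in> space M. \<bar>F \<omega> - expectation F\<bar> > t}
      \<le> prob ({\<omega> \<in> space M. l * F \<omega> - l * expectation F \<ge> l * t} \<union> {\<omega> \<in> space M. l * expectation F - l * F \<omega> \<ge> l * t})"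
  proof (rule finite_measure_mono)
    show "{\<omega> \<in> space M. \<bar>F \<omega> - expectation F\<bar> > t}
      \<subseteq> {\<omega> \<in> space M. l * F \<omega> - l * expectation F \<ge> l * t} \<union> {\<omega> \<in> space M. l * expectation F - l * F \<omega> \<ge> l * t}"
    proof
      fix \<omega> assume "\<omega> \<in> {\<omega> \<in> space M. \<bar>F \<omega> - expectation F\<bar> > t}"
      moreover from this have "t \<le> F \<omega> - expectation F \<or> t \<le> expectation F - F \<omega>" by auto
      ultimately show "\<omega> \<in> {\<omega> \<in> space M. l * F \<omega> - l * expectation F \<ge> l * t} \<union> {\<omega> \<in> space M. l * expectation F - l * F \<omega> \<ge> l * t}"
        using l by (auto simp flip: right_diff_distrib)
    qed
  qed measurable
  also have "\<dots> \<le> prob {\<omega> \<in> space M. l * F \<omega> - l * expectation F \<ge> l * t} + prob {\<omega> \<in> space M. l * expectation F - l * F \<omega> \<ge> l * t}"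
    by (rule measure_Un_le) measurable
  also have "\<dots> \<le> 2 * exp (- t\<^sup>2 / (32 * a\<^sup>2))" using p by linarith
  finally show ?thesis by (simp add: F_def)
qed

section \<open>Sums of rarely non-zero variables\<close>

locale orlicz =
  fixes \<Psi> :: "real \<Rightarrow> real"
  assumes orlicz: "orlicz_function \<Psi>"
begin

lemma orlicz_nonneg: "0 \<le> x \<Longrightarrow> 0 \<le> \<Psi> x"
  using orlicz by (simp add: orlicz_function_def)

lemma orlicz_mono: "0 \<le> x \<Longrightarrow> x \<le> y \<Longrightarrow> \<Psi> x \<le> \<Psi> y"
  using orlicz strict_mono_onD[of "{0..}" \<Psi> x y]
  by (cases "x = y") (auto simp: orlicz_function_def less_le)

lemma orlicz_contract:
  assumes "0 \<le> c" "c \<le> 1" "0 \<le> x"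
  shows "\<Psi> (c * x) \<le> c * \<Psi> x"
proof -
  have "convex_on {0..} \<Psi>" "\<Psi> 0 = 0" using orlicz by (auto simp: orlicz_function_def)
  then show ?thesis using convex_onD[of "{0..}" \<Psi> c 0 x] assms by simp
qed

lemma orlicz_one_pos: "0 < \<Psi> 1"
  using orlicz strict_mono_onD[of "{0..}" \<Psi> 0 1] by (auto simp: orlicz_function_def)

lemma orlicz_linear_lower_bound:
  assumes "1 \<le> x"
  shows "\<Psi> 1 * x \<le> \<Psi> x"
  using orlicz_contract[of "1 / x" x] assms by (simp add: field_simps)

text \<open>On positive arguments this is \<open>exp (\<psi> w)\<close>. It vanishes at \<open>0\<close>, so that in a sum over many variables
those that vanish do not contribute.\<close>

definition orlicz_weight :: "real \<Rightarrow> real" where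
  "orlicz_weight w = (if 0 < w then 1 + \<Psi> w else 0)"

lemma orlicz_weight_nonneg: "0 \<le> orlicz_weight w"
  using orlicz_nonneg[of w] by (simp add: orlicz_weight_def)

lemma borel_measurable_orlicz_weight [measurable]: "orlicz_weight \<in> borel_measurable borel"
proof (rule borel_measurable_mono)
  show "mono orlicz_weight"
    using orlicz_mono orlicz_nonneg by (intro monoI) (auto simp: orlicz_weight_def intro: add_nonneg_nonneg)
qed

lemma le_orlicz_weight:
  assumes "0 \<le> w"
  shows "w \<le> (1 + 1 / \<Psi> 1) * orlicz_weight w"
proof (cases "w = 0")
  case False
  with assms have w: "0 < w" by simp
  have "w \<le> 1 + \<Psi> w / \<Psi> 1"
  proof (cases "w \<le> 1")
    case True
    moreover have "0 \<le> \<Psi> w / \<Psi> 1" using orlicz_nonneg[of w] orlicz_one_pos w by simp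
    ultimately show ?thesis by linarith
  next
    case False
    then have "w \<le> \<Psi> w / \<Psi> 1"
      using orlicz_linear_lower_bound[of w] orlicz_one_pos by (simp add: field_simps)
    then show ?thesis by linarith
  qed
  also have "\<dots> \<le> (1 + \<Psi> w) * (1 + 1 / \<Psi> 1)"
    using orlicz_nonneg[of w] orlicz_one_pos w by (simp add: field_simps)
  finally show ?thesis using w by (simp add: orlicz_weight_def mult.commute)
qed (simp add: orlicz_weight_def)

text \<open>If some variable is positive while all the others vanish, its weight is at most \<open>1 + \<Psi> Z\<close>. These
events are disjoint for different indices, and given the value of the one variable the others vanish
with probability at least \<open>1 / 2\<close>, by independence. So the sum of the expected weights is at most twice
the expectation of \<open>1 + \<Psi> Z\<close>.\<close>

lemma sparse_orlicz_weight_sum: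
  fixes M :: "'a measure" and W :: "'i \<Rightarrow> 'a \<Rightarrow> real"
  assumes M: "prob_space M"
    and indep: "prob_space.indep_vars M (\<lambda>_. borel) W I" and I: "finite I"
    and W: "\<And>i \<omega>. i \<in> I \<Longrightarrow> \<omega> \<in> space M \<Longrightarrow> 0 \<le> W i \<omega> \<and> W i \<omega> \<le> Z \<omega>"
    and Z: "\<And>\<omega>. \<omega> \<in> space M \<Longrightarrow> 0 \<le> Z \<omega>"
    and sparse: "1 / 2 \<le> measure M {\<omega> \<in> space M. \<forall>i\<in>I. W i \<omega> = 0}"
    and max: "(\<integral>\<^sup>+\<omega>. ennreal (1 + \<Psi> (Z \<omega>)) \<partial>M) \<le> 2"
  shows "(\<Sum>i\<in>I. \<integral>\<^sup>+\<omega>. ennreal (orlicz_weight (W i \<omega>)) \<partial>M) \<le> 4"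
proof -
  interpret prob_space M by (rule M)
  have rv [measurable]: "i \<in> I \<Longrightarrow> W i \<in> borel_measurable M" for i
    using indep by (auto simp: indep_vars_def)
  define p where "p = (\<lambda>j. \<integral>\<^sup>+\<omega>. indicator {0} (W j \<omega>) \<partial>M)"
  define w where "w = (\<lambda>i. \<integral>\<^sup>+\<omega>. ennreal (orlicz_weight (W i \<omega>)) \<partial>M)"
  \<comment> \<open>The product of \<open>only i j (W j \<omega>)\<close> over \<open>j\<close> is the weight of \<open>W i \<omega>\<close> on the event that all other
    variables vanish, and \<open>0\<close> elsewhere.\<close>
  define only where "only = (\<lambda>(i :: 'i) j x. if j = i then ennreal (orlicz_weight x) else indicator {0} x)"
  have only_meas: "only i j \<in> borel_measurable borel" for i j
    unfolding only_def by (cases "j = i") simp_all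
  have p_le: "p j \<le> 1" for j
  proof -
    have "p j \<le> (\<integral>\<^sup>+\<omega>. 1 \<partial>M)" unfolding p_def by (intro nn_integral_mono) (auto simp: indicator_def)
    then show ?thesis by (simp add: emeasure_space_1)
  qed
  have half: "ennreal (1 / 2) \<le> (\<Prod>j\<in>I. p j)"
  proof -
    have "ennreal (1 / 2) \<le> emeasure M {\<omega> \<in> space M. \<forall>i\<in>I. W i \<omega> = 0}"
      unfolding emeasure_eq_measure by (rule ennreal_leI[OF sparse])
    also have "\<dots> = (\<integral>\<^sup>+\<omega>. indicator {\<omega> \<in> space M. \<forall>i\<in>I. W i \<omega> = 0} \<omega> \<partial>M)"
      using I by (intro nn_integral_indicator[symmetric]) measurable
    also have "\<dots> = (\<integral>\<^sup>+\<omega>. (\<Prod>j\<in>I. indicator {0} (W j \<omega>)) \<partial>M)"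
    proof (intro nn_integral_cong)
      fix \<omega> assume "\<omega> \<in> space M"
      then show "(indicator {\<omega> \<in> space M. \<forall>i\<in>I. W i \<omega> = 0} \<omega> :: ennreal) = (\<Prod>j\<in>I. indicator {0} (W j \<omega>))"
        using I by (cases "\<forall>i\<in>I. W i \<omega> = 0") (auto simp: indicator_def intro!: prod_zero[symmetric])
    qed
    also have "\<dots> = (\<Prod>j\<in>I. p j)"
      unfolding p_def by (intro indep_vars_nn_integral I indep_vars_compose2[OF indep]) auto
    finally show ?thesis .
  qed
  have summand: "w i * ennreal (1 / 2) \<le> (\<integral>\<^sup>+\<omega>. (\<Prod>j\<in>I. only i j (W j \<omega>)) \<partial>M)" if i: "i \<in> I" for i
  proof -
    have "(\<Prod>j\<in>I. p j) = p i * (\<Prod>j\<in>I - {i}. p j)" by (rule prod.remove[OF I i])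
    also have "\<dots> \<le> 1 * (\<Prod>j\<in>I - {i}. p j)" by (intro mult_right_mono p_le) simp
    finally have "ennreal (1 / 2) \<le> (\<Prod>j\<in>I - {i}. p j)" using half by simp
    then have "w i * ennreal (1 / 2) \<le> w i * (\<Prod>j\<in>I - {i}. p j)" by (intro mult_left_mono) auto
    also have "\<dots> = (\<Prod>j\<in>I. \<integral>\<^sup>+\<omega>. only i j (W j \<omega>) \<partial>M)"
      unfolding prod.remove[OF I i] by (auto simp: only_def w_def p_def intro!: prod.cong arg_cong2[where f = "(*)"])
    also have "\<dots> = (\<integral>\<^sup>+\<omega>. (\<Prod>j\<in>I. only i j (W j \<omega>)) \<partial>M)"
      by (intro indep_vars_nn_integral[symmetric] I indep_vars_compose2[OF indep] only_meas) auto
    finally show ?thesis .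
  qed
  have "(\<Sum>i\<in>I. w i) * ennreal (1 / 2) = (\<Sum>i\<in>I. w i * ennreal (1 / 2))" by (rule sum_distrib_right)
  also have "\<dots> \<le> (\<Sum>i\<in>I. \<integral>\<^sup>+\<omega>. (\<Prod>j\<in>I. only i j (W j \<omega>)) \<partial>M)" by (intro sum_mono summand)
  also have "\<dots> = (\<integral>\<^sup>+\<omega>. (\<Sum>i\<in>I. \<Prod>j\<in>I. only i j (W j \<omega>)) \<partial>M)"
    by (intro nn_integral_sum[symmetric] borel_measurable_prod_ennreal measurable_compose[OF rv only_meas]) auto
  also have "\<dots> \<le> (\<integral>\<^sup>+\<omega>. ennreal (1 + \<Psi> (Z \<omega>)) \<partial>M)"
  proof (intro nn_integral_mono)
    fix \<omega> assume \<omega>: "\<omega> \<in> space M"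
    show "(\<Sum>i\<in>I. \<Prod>j\<in>I. only i j (W j \<omega>)) \<le> ennreal (1 + \<Psi> (Z \<omega>))"
    proof (cases "\<exists>i\<in>I. (\<Prod>j\<in>I. only i j (W j \<omega>)) \<noteq> 0")
      case True
      then obtain i where i: "i \<in> I" and nz: "(\<Prod>j\<in>I. only i j (W j \<omega>)) \<noteq> 0" by blast
      have nzj: "only i j (W j \<omega>) \<noteq> 0" if "j \<in> I" for j
      proof
        assume "only i j (W j \<omega>) = 0"
        then have "(\<Prod>j\<in>I. only i j (W j \<omega>)) = 0" using that by (intro prod_zero[OF I]) auto
        with nz show False by simp
      qed
      have zero: "W j \<omega> = 0" if "j \<in> I" "j \<noteq> i" for j
        using nzj[OF that(1)] that(2) by (auto simp: only_def indicator_def split: if_splits)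
      have other: "(\<Prod>j\<in>I. only k j (W j \<omega>)) = 0" if "k \<in> I" "k \<noteq> i" for k
        using that zero[OF that] I by (intro prod_zero) (auto simp: only_def orlicz_weight_def intro!: bexI[of _ k])
      have "(\<Sum>k\<in>I. \<Prod>j\<in>I. only k j (W j \<omega>)) = (\<Prod>j\<in>I. only i j (W j \<omega>))"
        using sum.remove[OF I i, of "\<lambda>k. \<Prod>j\<in>I. only k j (W j \<omega>)"] other by simp
      also have "\<dots> = only i i (W i \<omega>) * (\<Prod>j\<in>I - {i}. only i j (W j \<omega>))" by (rule prod.remove[OF I i])
      also have "(\<Prod>j\<in>I - {i}. only i j (W j \<omega>)) = 1"
        by (rule prod.neutral) (auto simp: only_def zero)
      also have "only i i (W i \<omega>) * 1 = ennreal (orlicz_weight (W i \<omega>))" by (simp add: only_def)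
      also have "\<dots> \<le> ennreal (1 + \<Psi> (Z \<omega>))"
      proof (rule ennreal_leI)
        show "orlicz_weight (W i \<omega>) \<le> 1 + \<Psi> (Z \<omega>)"
          using W[OF i \<omega>] orlicz_mono[of "W i \<omega>" "Z \<omega>"] orlicz_nonneg[OF Z[OF \<omega>]]
          by (auto simp: orlicz_weight_def)
      qed
      finally show ?thesis .
    next
      case False
      then have "(\<Sum>i\<in>I. \<Prod>j\<in>I. only i j (W j \<omega>)) = 0" by (intro sum.neutral) auto
      then show ?thesis by simp
    qed
  qed
  also note max
  finally have "(\<Sum>i\<in>I. w i) * ennreal (1 / 2) \<le> 2" .
  then have "(\<Sum>i\<in>I. w i) * ennreal (1 / 2) * 2 \<le> 2 * 2" by (rule mult_right_mono) simp
  moreover have "(\<Sum>i\<in>I. w i) * ennreal (1 / 2) * 2 = (\<Sum>i\<in>I. w i)"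
  proof -
    have "ennreal (1 / 2) * 2 = ennreal (1 / 2) * ennreal 2" by simp
    also have "\<dots> = 1" by (subst ennreal_mult[symmetric]) auto
    finally show ?thesis by (simp add: mult.assoc)
  qed
  ultimately show ?thesis by (simp add: w_def)
qed

end

text \<open>The growth condition on \<open>\<psi> = ln (1 + \<Psi>)\<close>. The condition persists when \<open>K\<close> is enlarged, so that
\<open>1 \<le> K\<close> can always be arranged.\<close>

locale orlicz_growth = orlicz +
  fixes K :: real
  assumes K: "1 \<le> K"
    and growth: "\<And>s u. K \<le> s \<Longrightarrow> K \<le> u \<Longrightarrow> ln (1 + \<Psi> (s * u)) \<le> K * (s * ln (1 + s) + s * ln (1 + \<Psi> u))"
begin

text \<open>The first entry lets the exponent in the lemma below be absorbed by the growth condition, the second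
one makes the expected truncated exponentials small enough for Chernoff's method.\<close>

definition tail_const :: real where
  "tail_const = max (4 * K) (8 * (1 + \<Psi> K) * sqrt (2 / \<Psi> 1))"

lemma tail_const_pos: "0 < tail_const"
  using K by (simp add: tail_const_def less_max_iff_disj)

text \<open>With \<open>u = max w K\<close> and \<open>T = s * u\<close> the growth condition gives
\<open>2 * l * u \<le> ln (1 + s) + ln (1 + \<Psi> u)\<close>, so that \<open>exp (l * u)\<close> is at most the square root of
\<open>(1 + s) * (1 + \<Psi> u)\<close>. As \<open>u\<close> itself is bounded by a multiple of \<open>1 + \<Psi> u\<close>, the product
\<open>u * exp (l * u)\<close> is bounded by a constant times \<open>1 + \<Psi> u\<close> and the square root of \<open>T\<close>, and the square
root is at most \<open>T\<close>. The truncation level is \<open>\<tau> = T / K\<close>, and not \<open>T\<close>, to ensure that \<open>s \<ge> K\<close>.\<close>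

lemma truncated_exponential_bound:
  assumes \<tau>: "K \<le> \<tau>" and T: "T = K * \<tau>" and l: "l = 2 * ln (1 + \<Psi> T) / (tail_const * T)"
    and w: "0 < w" "w \<le> \<tau>"
  shows "w * exp (l * w) \<le> sqrt (2 * T / \<Psi> 1) * (1 + \<Psi> K) * (1 + \<Psi> w)"
proof -
  define u where "u = max w K"
  define s where "s = T / u"
  have u: "K \<le> u" "w \<le> u" "u \<le> \<tau>" "1 \<le> u" using \<tau> w K by (auto simp: u_def)
  have T1: "1 \<le> T" unfolding T using K \<tau> mult_mono[of 1 K 1 \<tau>] by simp
  have s: "K \<le> s" "s * u = T"
    using u K mult_left_mono[of u \<tau> K] by (auto simp: s_def T field_simps)
  have G: "1 \<le> 1 + \<Psi> u" "0 \<le> \<Psi> T" using orlicz_nonneg u T1 by auto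
  have l0: "0 \<le> l" unfolding l using G T1 tail_const_pos by simp
  have "2 * (l * u) = 4 * ln (1 + \<Psi> T) / (tail_const * s)"
    using s u K T1 tail_const_pos unfolding l s(2)[symmetric] by (simp add: field_simps)
  also have "\<dots> \<le> 4 * ln (1 + \<Psi> T) / (4 * K * s)"
    using s K G by (intro divide_left_mono mult_right_mono mult_pos_pos mult_nonneg_nonneg tail_const_pos)
       (auto simp: tail_const_def)
  also have "\<dots> \<le> 4 * (K * (s * ln (1 + s) + s * ln (1 + \<Psi> u))) / (4 * K * s)"
    using growth[OF s(1) u(1)] s K by (intro divide_right_mono) (auto simp: s(2))
  also have "\<dots> = ln (1 + s) + ln (1 + \<Psi> u)"
    using s K by (simp add: field_simps)
  also have "\<dots> = ln ((1 + s) * (1 + \<Psi> u))"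
    using s K G by (simp add: ln_mult)
  finally have "exp (2 * (l * u)) \<le> (1 + s) * (1 + \<Psi> u)"
    using s K G by (subst ln_ge_iff[symmetric]) auto
  also have "\<dots> \<le> (2 * s) * (1 + \<Psi> u)" using s K G by (intro mult_right_mono) auto
  finally have "u\<^sup>2 * exp (2 * (l * u)) \<le> u\<^sup>2 * ((2 * s) * (1 + \<Psi> u))" by (intro mult_left_mono) auto
  also have "\<dots> = (2 * T) * (u * (1 + \<Psi> u))" by (simp add: s(2)[symmetric] power2_eq_square)
  also have "\<dots> \<le> (2 * T) * ((1 + \<Psi> u) / \<Psi> 1 * (1 + \<Psi> u))"
    using orlicz_linear_lower_bound[OF u(4)] orlicz_one_pos G T1
    by (intro mult_left_mono mult_right_mono) (auto simp: field_simps)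
  also have "\<dots> = (sqrt (2 * T / \<Psi> 1) * (1 + \<Psi> u))\<^sup>2"
    unfolding power_mult_distrib using orlicz_one_pos T1 by (simp add: power2_eq_square[of "1 + \<Psi> u"])
  also have "u\<^sup>2 * exp (2 * (l * u)) = (u * exp (l * u))\<^sup>2"
    by (simp add: power_mult_distrib exp_double)
  finally have "u * exp (l * u) \<le> sqrt (2 * T / \<Psi> 1) * (1 + \<Psi> u)"
    by (rule power2_le_imp_le) (use orlicz_one_pos T1 G in auto)
  moreover have "w * exp (l * w) \<le> u * exp (l * u)"
    using u w l0 by (intro mult_mono) (auto intro: mult_left_mono)
  moreover have "1 + \<Psi> u \<le> (1 + \<Psi> K) * (1 + \<Psi> w)"
    using orlicz_nonneg[of K] orlicz_nonneg[of w] w K by (auto simp: u_def max_def algebra_simps)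
  then have "sqrt (2 * T / \<Psi> 1) * (1 + \<Psi> u) \<le> sqrt (2 * T / \<Psi> 1) * ((1 + \<Psi> K) * (1 + \<Psi> w))"
    using orlicz_one_pos T1 by (intro mult_left_mono) auto
  ultimately show ?thesis by (simp add: mult.assoc)
qed

text \<open>Either some variable exceeds \<open>\<tau>\<close>, which is controlled by Markov's inequality for the weights, or the
sum is large although all terms are at most \<open>\<tau>\<close>. For the latter Chernoff's method is applied to the
truncated variables with the parameter \<open>l\<close> for which the main exponent \<open>l * tail_const * T\<close> equals
\<open>2 * ln (1 + \<Psi> T)\<close>. Half of it compensates the exponential moments, and the other half yields the
bound \<open>1 / (1 + \<Psi> T)\<close>.\<close>

lemma sum_tail_bound:
  fixes M :: "'a measure" and W :: "'i \<Rightarrow> 'a \<Rightarrow> real"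
  assumes M: "prob_space M"
    and indep: "prob_space.indep_vars M (\<lambda>_. borel) W I" and I: "finite I"
    and W: "\<And>i \<omega>. i \<in> I \<Longrightarrow> \<omega> \<in> space M \<Longrightarrow> 0 \<le> W i \<omega>"
    and sum: "(\<Sum>i\<in>I. \<integral>\<^sup>+\<omega>. ennreal (orlicz_weight (W i \<omega>)) \<partial>M) \<le> 4"
    and \<tau>: "K \<le> \<tau>"
  shows "measure M {\<omega> \<in> space M. (\<Sum>i\<in>I. W i \<omega>) \<ge> tail_const * K * \<tau>} \<le> 5 / (1 + \<Psi> \<tau>)"
proof -
  interpret prob_space M by (rule M)
  have rv [measurable]: "i \<in> I \<Longrightarrow> W i \<in> borel_measurable M" for i
    using indep by (auto simp: indep_vars_def)
  define T where "T = K * \<tau>"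
  define l where "l = 2 * ln (1 + \<Psi> T) / (tail_const * T)"
  define B where "B = sqrt (2 * T / \<Psi> 1) * (1 + \<Psi> K)"
  define V where "V = (\<lambda>i \<omega>. if W i \<omega> \<le> \<tau> then W i \<omega> else 0)"
  define r where "r = (\<lambda>i. enn2real (\<integral>\<^sup>+\<omega>. ennreal (orlicz_weight (W i \<omega>)) \<partial>M))"
  have \<tau>1: "1 \<le> \<tau>" using K \<tau> by simp
  have T1: "1 \<le> T" unfolding T_def using K \<tau> mult_mono[of 1 K 1 \<tau>] by simp
  have \<tau>T: "\<tau> \<le> T" unfolding T_def using K \<tau> mult_right_mono[of 1 K \<tau>] by simp
  have \<Psi>T: "0 < \<Psi> T" using orlicz_mono[of 1 T] orlicz_one_pos T1 by simp
  have \<Psi>\<tau>: "0 \<le> \<Psi> \<tau>" "\<Psi> \<tau> \<le> \<Psi> T" using orlicz_nonneg[of \<tau>] orlicz_mono[of \<tau> T] \<tau>1 \<tau>T by auto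
  have l: "0 < l" unfolding l_def using \<Psi>T T1 tail_const_pos by simp
  have B: "0 \<le> B" unfolding B_def using T1 orlicz_one_pos orlicz_nonneg[of K] K by simp
  have r0: "0 \<le> r i" for i by (simp add: r_def)
  have r: "(\<integral>\<^sup>+\<omega>. ennreal (orlicz_weight (W i \<omega>)) \<partial>M) = ennreal (r i)" if "i \<in> I" for i
  proof -
    have "(\<integral>\<^sup>+\<omega>. ennreal (orlicz_weight (W i \<omega>)) \<partial>M) \<le> 4"
      using member_le_sum[OF that _ I, of "\<lambda>i. \<integral>\<^sup>+\<omega>. ennreal (orlicz_weight (W i \<omega>)) \<partial>M"] sum by simp
    also have "(4 :: ennreal) < \<top>" by simp
    finally show ?thesis unfolding r_def by simp
  qed
  have sum_r: "(\<Sum>i\<in>I. r i) \<le> 4"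
  proof -
    have "ennreal (\<Sum>i\<in>I. r i) = (\<Sum>i\<in>I. ennreal (r i))"
      by (rule sum_ennreal[symmetric]) (rule r0)
    also have "\<dots> = (\<Sum>i\<in>I. \<integral>\<^sup>+\<omega>. ennreal (orlicz_weight (W i \<omega>)) \<partial>M)"
      by (rule sum.cong) (simp_all add: r)
    also have "\<dots> \<le> ennreal 4" using sum by simp
    finally show ?thesis by (subst (asm) ennreal_le_iff) auto
  qed
  have Vpt: "exp (l * V i \<omega>) \<le> 1 + l * B * orlicz_weight (W i \<omega>)" if "i \<in> I" "\<omega> \<in> space M" for i \<omega>
  proof (cases "0 < W i \<omega> \<and> W i \<omega> \<le> \<tau>")
    case True
    let ?x = "l * W i \<omega>"
    \<comment> \<open>The inequality \<open>exp x \<le> 1 + x * exp x\<close>.\<close>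
    have "(1 - ?x) * exp ?x \<le> exp (- ?x) * exp ?x"
      using exp_ge_add_one_self[of "- ?x"] by (intro mult_right_mono) auto
    then have "exp ?x \<le> 1 + l * (W i \<omega> * exp ?x)" by (simp add: exp_add[symmetric] algebra_simps)
    also have "\<dots> \<le> 1 + l * (B * (1 + \<Psi> (W i \<omega>)))"
      using truncated_exponential_bound[OF \<tau> T_def l_def, of "W i \<omega>"] True l
      by (intro add_left_mono mult_left_mono) (auto simp: B_def)
    finally show ?thesis using True by (simp add: V_def orlicz_weight_def mult.assoc)
  next
    case False
    then have "V i \<omega> = 0" using W[OF that] by (auto simp: V_def)
    then show ?thesis using l B orlicz_weight_nonneg[of "W i \<omega>"] by simp
  qed
  have "(\<integral>\<^sup>+\<omega>. ennreal (exp (l * (\<Sum>i\<in>I. V i \<omega>))) \<partial>M) = (\<integral>\<^sup>+\<omega>. (\<Prod>i\<in>I. ennreal (exp (l * V i \<omega>))) \<partial>M)"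
    using I by (simp add: sum_distrib_left exp_sum prod_ennreal)
  also have "\<dots> = (\<Prod>i\<in>I. \<integral>\<^sup>+\<omega>. ennreal (exp (l * V i \<omega>)) \<partial>M)"
    unfolding V_def by (intro indep_vars_nn_integral I indep_vars_compose2[OF indep]) auto
  also have "\<dots> \<le> (\<Prod>i\<in>I. ennreal (exp (l * B * r i)))"
  proof (rule prod_mono_ennreal)
    fix i assume i: "i \<in> I"
    have "(\<integral>\<^sup>+\<omega>. ennreal (exp (l * V i \<omega>)) \<partial>M) \<le> (\<integral>\<^sup>+\<omega>. 1 + ennreal (l * B) * ennreal (orlicz_weight (W i \<omega>)) \<partial>M)"
    proof (intro nn_integral_mono)
      fix \<omega> assume "\<omega> \<in> space M"
      from ennreal_leI[OF Vpt[OF i this]]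
      show "ennreal (exp (l * V i \<omega>)) \<le> 1 + ennreal (l * B) * ennreal (orlicz_weight (W i \<omega>))"
        using l B orlicz_weight_nonneg by (simp add: ennreal_mult)
    qed
    also have "\<dots> = 1 + ennreal (l * B) * ennreal (r i)"
      using i r[OF i] by (simp add: nn_integral_add nn_integral_cmult emeasure_space_1)
    also have "\<dots> = ennreal (1 + l * B * r i)"
      using l B r0[of i] by (simp add: ennreal_mult)
    also have "\<dots> \<le> ennreal (exp (l * B * r i))" by (intro ennreal_leI) simp
    finally show "(\<integral>\<^sup>+\<omega>. ennreal (exp (l * V i \<omega>)) \<partial>M) \<le> ennreal (exp (l * B * r i))" .
  qed
  also have "\<dots> = ennreal (exp (l * B * (\<Sum>i\<in>I. r i)))"
    using I by (simp add: prod_ennreal exp_sum[symmetric] sum_distrib_left)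
  also have "\<dots> \<le> ennreal (exp (l * B * 4))"
    using l B sum_r by (intro ennreal_leI) (auto intro: mult_left_mono)
  finally have moment: "(\<integral>\<^sup>+\<omega>. ennreal (exp (l * (\<Sum>i\<in>I. V i \<omega>))) \<partial>M) \<le> ennreal (exp (l * B * 4))" .
  have "prob {\<omega> \<in> space M. l * (\<Sum>i\<in>I. V i \<omega>) \<ge> l * (tail_const * T)} \<le> exp (- (l * (tail_const * T))) * exp (l * B * 4)"
    by (rule prob_ge_le_exp_moment[OF _ moment]) (auto simp: V_def)
  also have "\<dots> \<le> exp (- ln (1 + \<Psi> T))"
  proof -
    have "sqrt T \<le> T" using T1 by (intro real_le_lsqrt) (auto simp: power2_eq_square)
    then have "8 * B \<le> 8 * (sqrt (2 / \<Psi> 1) * T) * (1 + \<Psi> K)"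
      using orlicz_one_pos orlicz_nonneg[of K] K unfolding B_def
      by (auto simp: real_sqrt_mult real_sqrt_divide intro!: mult_right_mono divide_right_mono)
    also have "\<dots> = (8 * (1 + \<Psi> K) * sqrt (2 / \<Psi> 1)) * T" by simp
    also have "\<dots> \<le> tail_const * T" using T1 by (intro mult_right_mono) (auto simp: tail_const_def)
    finally have "l * (8 * B) \<le> l * (tail_const * T)" using l by (intro mult_left_mono) auto
    moreover have "l * (tail_const * T) = 2 * ln (1 + \<Psi> T)" using T1 tail_const_pos by (simp add: l_def)
    ultimately show ?thesis by (simp add: exp_add[symmetric] mult_ac)
  qed
  also have "\<dots> = 1 / (1 + \<Psi> T)" using \<Psi>T by (simp add: exp_minus inverse_eq_divide)
  also have "\<dots> \<le> 1 / (1 + \<Psi> \<tau>)" using \<Psi>\<tau> by (intro divide_left_mono) auto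
  finally have small: "prob {\<omega> \<in> space M. (\<Sum>i\<in>I. V i \<omega>) \<ge> tail_const * T} \<le> 1 / (1 + \<Psi> \<tau>)"
    using l by simp
  have large: "prob {\<omega> \<in> space M. W i \<omega> > \<tau>} \<le> r i / (1 + \<Psi> \<tau>)" if i: "i \<in> I" for i
  proof -
    have "emeasure M {\<omega> \<in> space M. W i \<omega> > \<tau>}
        \<le> emeasure M {\<omega> \<in> space M. 1 \<le> ennreal (1 / (1 + \<Psi> \<tau>)) * ennreal (orlicz_weight (W i \<omega>))}"
    proof (rule emeasure_mono)
      show "{\<omega> \<in> space M. W i \<omega> > \<tau>} \<subseteq> {\<omega> \<in> space M. 1 \<le> ennreal (1 / (1 + \<Psi> \<tau>)) * ennreal (orlicz_weight (W i \<omega>))}"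
      proof
        fix \<omega> assume \<omega>: "\<omega> \<in> {\<omega> \<in> space M. W i \<omega> > \<tau>}"
        then have "1 \<le> 1 / (1 + \<Psi> \<tau>) * orlicz_weight (W i \<omega>)"
          using orlicz_mono[of \<tau> "W i \<omega>"] \<tau>1 \<Psi>\<tau> by (simp add: orlicz_weight_def field_simps)
        from ennreal_leI[OF this] \<omega> show "\<omega> \<in> {\<omega> \<in> space M. 1 \<le> ennreal (1 / (1 + \<Psi> \<tau>)) * ennreal (orlicz_weight (W i \<omega>))}"
          using orlicz_weight_nonneg \<Psi>\<tau> by (simp add: ennreal_mult[symmetric])
      qed
    qed (use i in measurable)
    also have "\<dots> \<le> ennreal (1 / (1 + \<Psi> \<tau>)) * (\<integral>\<^sup>+\<omega>. ennreal (orlicz_weight (W i \<omega>)) * indicator (space M) \<omega> \<partial>M)"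
      using i by (intro nn_integral_Markov_inequality) auto
    also have "(\<integral>\<^sup>+\<omega>. ennreal (orlicz_weight (W i \<omega>)) * indicator (space M) \<omega> \<partial>M) = ennreal (r i)"
      unfolding r[OF i, symmetric] by (intro nn_integral_cong) simp
    also have "ennreal (1 / (1 + \<Psi> \<tau>)) * ennreal (r i) = ennreal (r i / (1 + \<Psi> \<tau>))"
      using \<Psi>\<tau> r0[of i] by (simp add: ennreal_mult[symmetric])
    finally show ?thesis using \<Psi>\<tau> r0[of i] by (simp add: emeasure_eq_measure)
  qed
  have large_event: "(\<Union>i\<in>I. {\<omega> \<in> space M. W i \<omega> > \<tau>}) \<in> events"
    using I by (intro sets.finite_UN) auto
  have small_event: "{\<omega> \<in> space M. (\<Sum>i\<in>I. V i \<omega>) \<ge> tail_const * T} \<in> events"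
    unfolding V_def by measurable
  have "prob {\<omega> \<in> space M. (\<Sum>i\<in>I. W i \<omega>) \<ge> tail_const * T}
      \<le> prob ({\<omega> \<in> space M. (\<Sum>i\<in>I. V i \<omega>) \<ge> tail_const * T} \<union> (\<Union>i\<in>I. {\<omega> \<in> space M. W i \<omega> > \<tau>}))"
  proof (rule finite_measure_mono)
    show "{\<omega> \<in> space M. (\<Sum>i\<in>I. W i \<omega>) \<ge> tail_const * T}
        \<subseteq> {\<omega> \<in> space M. (\<Sum>i\<in>I. V i \<omega>) \<ge> tail_const * T} \<union> (\<Union>i\<in>I. {\<omega> \<in> space M. W i \<omega> > \<tau>})"
    proof
      fix \<omega> assume \<omega>: "\<omega> \<in> {\<omega> \<in> space M. (\<Sum>i\<in>I. W i \<omega>) \<ge> tail_const * T}"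
      show "\<omega> \<in> {\<omega> \<in> space M. (\<Sum>i\<in>I. V i \<omega>) \<ge> tail_const * T} \<union> (\<Union>i\<in>I. {\<omega> \<in> space M. W i \<omega> > \<tau>})"
      proof (cases "\<exists>i\<in>I. W i \<omega> > \<tau>")
        case False
        then have "(\<Sum>i\<in>I. V i \<omega>) = (\<Sum>i\<in>I. W i \<omega>)" by (intro sum.cong) (auto simp: V_def)
        with \<omega> show ?thesis by simp
      qed (use \<omega> in auto)
    qed
    show "{\<omega> \<in> space M. (\<Sum>i\<in>I. V i \<omega>) \<ge> tail_const * T} \<union> (\<Union>i\<in>I. {\<omega> \<in> space M. W i \<omega> > \<tau>}) \<in> events"
      using large_event small_event by blast
  qed
  also have "\<dots> \<le> prob {\<omega> \<in> space M. (\<Sum>i\<in>I. V i \<omega>) \<ge> tail_const * T} + prob (\<Union>i\<in>I. {\<omega> \<in> space M. W i \<omega> > \<tau>})"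
    by (rule measure_Un_le[OF small_event large_event])
  also have "prob (\<Union>i\<in>I. {\<omega> \<in> space M. W i \<omega> > \<tau>}) \<le> (\<Sum>i\<in>I. prob {\<omega> \<in> space M. W i \<omega> > \<tau>})"
    using I by (intro measure_UNION_le) auto
  also have "\<dots> \<le> (\<Sum>i\<in>I. r i / (1 + \<Psi> \<tau>))" by (intro sum_mono large)
  also have "\<dots> \<le> 4 / (1 + \<Psi> \<tau>)"
    unfolding sum_divide_distrib[symmetric] using sum_r \<Psi>\<tau> by (intro divide_right_mono) auto
  finally show ?thesis using small by (simp add: T_def mult.assoc add_divide_distrib[symmetric])
qed

end

section \<open>Truncation at twice the mean of the maximum\<close>

context orlicz
begin

lemma borel_measurable_orlicz:
  assumes [measurable]: "u \<in> borel_measurable M" and nn: "\<And>x. x \<in> space M \<Longrightarrow> 0 \<le> u x"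
  shows "(\<lambda>x. \<Psi> (u x)) \<in> borel_measurable M"
proof -
  have "mono (\<lambda>x. \<Psi> (max 0 x))" by (intro monoI orlicz_mono) auto
  from borel_measurable_mono[OF this] have "(\<lambda>x. \<Psi> (max 0 (u x))) \<in> borel_measurable M" by measurable
  then show ?thesis by (rule measurable_cong[THEN iffD1, rotated]) (simp add: nn max_absorb2)
qed

text \<open>By Markov's inequality the maximum exceeds twice its mean with probability at most \<open>1 / 2\<close>; otherwise
all exceedances vanish.\<close>

lemma exceedance_weight_sum:
  fixes M :: "'a measure" and X :: "'i \<Rightarrow> 'a \<Rightarrow> real"
  assumes M: "prob_space M"
    and indep: "prob_space.indep_vars M (\<lambda>_. borel) X I" and I: "finite I"
    and XR: "\<And>i \<omega>. i \<in> I \<Longrightarrow> \<omega> \<in> space M \<Longrightarrow> \<bar>X i \<omega>\<bar> \<le> R \<omega>"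
    and R: "integrable M R" "\<And>\<omega>. \<omega> \<in> space M \<Longrightarrow> 0 \<le> R \<omega>" and pos: "0 < (\<integral>\<omega>. R \<omega> \<partial>M)"
    and b: "0 < b" "(\<integral>\<^sup>+\<omega>. ennreal (\<Psi> ((R \<omega> / b)\<^sup>2)) \<partial>M) \<le> 1"
  shows "(\<Sum>i\<in>I. \<integral>\<^sup>+\<omega>. ennreal (orlicz_weight (if \<bar>X i \<omega>\<bar> > 2 * (\<integral>\<omega>. R \<omega> \<partial>M) then (X i \<omega> / b)\<^sup>2 else 0)) \<partial>M) \<le> 4"
proof -
  interpret prob_space M by (rule M)
  define a where "a = 2 * expectation R"
  have [measurable]: "R \<in> borel_measurable M" using R(1) by auto
  have rv [measurable]: "i \<in> I \<Longrightarrow> X i \<in> borel_measurable M" for i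
    using indep by (auto simp: indep_vars_def)
  define W where "W = (\<lambda>i \<omega>. if \<bar>X i \<omega>\<bar> > a then (X i \<omega> / b)\<^sup>2 else 0)"
  have W_indep: "indep_vars (\<lambda>_. borel) W I"
    unfolding W_def by (rule indep_vars_compose2[OF indep]) measurable
  have "(\<Sum>i\<in>I. \<integral>\<^sup>+\<omega>. ennreal (orlicz_weight (W i \<omega>)) \<partial>M) \<le> 4"
  proof (rule sparse_orlicz_weight_sum[OF M W_indep I, where Z = "\<lambda>\<omega>. (R \<omega> / b)\<^sup>2"])
    fix i \<omega> assume "i \<in> I" "\<omega> \<in> space M"
    from XR[OF this] have "\<bar>X i \<omega> / b\<bar> \<le> \<bar>R \<omega> / b\<bar>"
      using b by (simp add: abs_divide divide_right_mono)
    then have "(X i \<omega> / b)\<^sup>2 \<le> (R \<omega> / b)\<^sup>2" by (rule abs_le_square_iff[THEN iffD1])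
    then show "0 \<le> W i \<omega> \<and> W i \<omega> \<le> (R \<omega> / b)\<^sup>2" by (simp add: W_def)
  next
    have "prob {\<omega> \<in> space M. R \<omega> \<ge> a} \<le> expectation R / a"
      using R pos by (intro integral_Markov_inequality_measure[where A = "space M"]) (auto simp: a_def)
    then have "prob {\<omega> \<in> space M. R \<omega> \<ge> a} \<le> 1 / 2" using pos by (simp add: a_def)
    moreover have "1 = prob ({\<omega> \<in> space M. R \<omega> \<ge> a} \<union> {\<omega> \<in> space M. \<forall>i\<in>I. W i \<omega> = 0})"
    proof -
      have "{\<omega> \<in> space M. R \<omega> \<ge> a} \<union> {\<omega> \<in> space M. \<forall>i\<in>I. W i \<omega> = 0} = space M"
      proof -
        have "W i \<omega> = 0" if "i \<in> I" "\<omega> \<in> space M" "\<not> a \<le> R \<omega>" for i \<omega>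
          using XR[OF that(1,2)] that(3) by (simp add: W_def)
        then show ?thesis by auto
      qed
      then show ?thesis by (simp add: prob_space)
    qed
    moreover have "\<dots> \<le> prob {\<omega> \<in> space M. R \<omega> \<ge> a} + prob {\<omega> \<in> space M. \<forall>i\<in>I. W i \<omega> = 0}"
      using I unfolding W_def by (intro measure_Un_le) measurable
    ultimately show "1 / 2 \<le> prob {\<omega> \<in> space M. \<forall>i\<in>I. W i \<omega> = 0}" by linarith
  next
    have m: "(\<lambda>\<omega>. \<Psi> ((R \<omega> / b)\<^sup>2)) \<in> borel_measurable M"
      by (rule borel_measurable_orlicz) auto
    have "(\<integral>\<^sup>+\<omega>. ennreal (1 + \<Psi> ((R \<omega> / b)\<^sup>2)) \<partial>M) = (\<integral>\<^sup>+\<omega>. 1 + ennreal (\<Psi> ((R \<omega> / b)\<^sup>2)) \<partial>M)"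
      by (simp add: orlicz_nonneg)
    also have "\<dots> = 1 + (\<integral>\<^sup>+\<omega>. ennreal (\<Psi> ((R \<omega> / b)\<^sup>2)) \<partial>M)"
      using m by (subst nn_integral_add) (auto simp: emeasure_space_1)
    also have "\<dots> \<le> 1 + 1" by (intro add_left_mono b)
    finally show "(\<integral>\<^sup>+\<omega>. ennreal (1 + \<Psi> ((R \<omega> / b)\<^sup>2)) \<partial>M) \<le> 2" by simp
  qed simp
  then show ?thesis by (simp add: W_def a_def)
qed

text \<open>Up to the scale \<open>b\<close>, this bounds the change of the mean of \<open>f\<close> that is caused by the truncation.\<close>

definition mean_const :: real where
  "mean_const = 1 + 4 * (1 + 1 / \<Psi> 1)"

end

context orlicz_growth
begin

text \<open>Deviations \<open>t\<close> with \<open>(t / b)\<^sup>2\<close> above this value are at least three times the change of the mean and put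
\<open>\<tau>\<close> above \<open>K\<close> below. Smaller deviations are harmless, since for them the second term of the concentration
inequality is at least \<open>1\<close> when the constant is small.\<close>

definition threshold :: real where
  "threshold = 9 * (mean_const\<^sup>2 + tail_const * K\<^sup>2)"

text \<open>One third of the deviation \<open>t\<close> is allotted to the fluctuation of \<open>f Y\<close>, where \<open>Y\<close> is the truncation of
\<open>X\<close>, one third to the difference \<open>f X - f Y\<close>, and one third to the difference of their means. The square
of the second one is at most \<open>b\<^sup>2\<close> times the sum \<open>S\<close> of the scaled squared exceedances.\<close>

theorem convex_concentration_truncation:
  fixes M :: "'a measure" and X :: "'i::countable \<Rightarrow> 'a \<Rightarrow> real"
  assumes M: "prob_space M"
    and indep: "prob_space.indep_vars M (\<lambda>_. borel) X I" and I: "finite I" "I \<noteq> {}"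
    and XR: "\<And>i \<omega>. i \<in> I \<Longrightarrow> \<omega> \<in> space M \<Longrightarrow> \<bar>X i \<omega>\<bar> \<le> R \<omega>"
    and R: "integrable M R" "\<And>\<omega>. \<omega> \<in> space M \<Longrightarrow> 0 \<le> R \<omega>" and pos: "0 < (\<integral>\<omega>. R \<omega> \<partial>M)"
    and b: "0 < b" "(\<integral>\<^sup>+\<omega>. ennreal (\<Psi> ((R \<omega> / b)\<^sup>2)) \<partial>M) \<le> 1"
    and L: "lipschitz_coords I 1 f" and c: "convex_coords f"
    and t: "0 < t" "threshold < (t / b)\<^sup>2"
  defines "\<tau> \<equiv> (t / b)\<^sup>2 / (9 * (tail_const * K))"
  shows "measure M {\<omega> \<in> space M. \<bar>f (\<lambda>i. X i \<omega>) - (\<integral>\<omega>. f (\<lambda>i. X i \<omega>) \<partial>M)\<bar> > t}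
    \<le> 2 * exp (- t\<^sup>2 / (1152 * (\<integral>\<omega>. R \<omega> \<partial>M)\<^sup>2)) + min 1 (5 / (1 + \<Psi> \<tau>))"
proof -
  interpret prob_space M by (rule M)
  define a where "a = 2 * expectation R"
  have a: "0 < a" using pos by (simp add: a_def)
  have rv [measurable]: "i \<in> I \<Longrightarrow> X i \<in> borel_measurable M" for i
    using indep by (auto simp: indep_vars_def)
  define Y where "Y = (\<lambda>i \<omega>. if \<bar>X i \<omega>\<bar> > a then 0 else X i \<omega>)"
  define W where "W = (\<lambda>i \<omega>. if \<bar>X i \<omega>\<bar> > a then (X i \<omega> / b)\<^sup>2 else 0)"
  define S where "S = (\<lambda>\<omega>. \<Sum>i\<in>I. W i \<omega>)"
  define FX where "FX = (\<lambda>\<omega>. f (\<lambda>i. X i \<omega>))"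
  define FY where "FY = (\<lambda>\<omega>. f (\<lambda>i. Y i \<omega>))"
  have Y_indep: "indep_vars (\<lambda>_. borel) Y I"
    unfolding Y_def by (rule indep_vars_compose2[OF indep]) measurable
  have W_indep: "indep_vars (\<lambda>_. borel) W I"
    unfolding W_def by (rule indep_vars_compose2[OF indep]) measurable
  have Y_rv: "i \<in> I \<Longrightarrow> Y i \<in> borel_measurable M" for i unfolding Y_def by measurable
  have S_rv [measurable]: "S \<in> borel_measurable M" unfolding S_def W_def by measurable
  have W0: "0 \<le> W i \<omega>" for i \<omega> by (simp add: W_def)
  then have S0: "0 \<le> S \<omega>" for \<omega> by (simp add: S_def sum_nonneg)
  have weights: "(\<Sum>i\<in>I. \<integral>\<^sup>+\<omega>. ennreal (orlicz_weight (W i \<omega>)) \<partial>M) \<le> 4"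
    unfolding W_def a_def by (rule exceedance_weight_sum[OF M indep I(1) XR R pos b])
  have integrable_f: "integrable M (\<lambda>\<omega>. f (\<lambda>i. Z i \<omega>))"
    if Z: "\<And>i. i \<in> I \<Longrightarrow> Z i \<in> borel_measurable M"
      and ZR: "\<And>i \<omega>. i \<in> I \<Longrightarrow> \<omega> \<in> space M \<Longrightarrow> \<bar>Z i \<omega>\<bar> \<le> R \<omega>" for Z
  proof (rule Bochner_Integration.integrable_bound)
    show "integrable M (\<lambda>\<omega>. \<bar>f (\<lambda>_. 0)\<bar> + real (card I) * R \<omega>)" using R by simp
    show "(\<lambda>\<omega>. f (\<lambda>i. Z i \<omega>)) \<in> borel_measurable M"
      by (rule borel_measurable_lipschitz_compose[OF L I(1) Z])
    show "AE \<omega> in M. norm (f (\<lambda>i. Z i \<omega>)) \<le> norm (\<bar>f (\<lambda>_. 0)\<bar> + real (card I) * R \<omega>)"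
    proof (rule AE_I2)
      fix \<omega> assume \<omega>: "\<omega> \<in> space M"
      have "\<bar>f (\<lambda>i. Z i \<omega>) - f (\<lambda>_. 0)\<bar> \<le> L2_set (\<lambda>i. Z i \<omega>) I"
        using L[unfolded lipschitz_coords_def, rule_format, of "\<lambda>i. Z i \<omega>" "\<lambda>_. 0"] by simp
      also have "\<dots> \<le> (\<Sum>i\<in>I. \<bar>Z i \<omega>\<bar>)" by (rule L2_set_le_sum_abs)
      also have "\<dots> \<le> real (card I) * R \<omega>" using ZR \<omega> by (intro sum_bounded_above) auto
      finally show "norm (f (\<lambda>i. Z i \<omega>)) \<le> norm (\<bar>f (\<lambda>_. 0)\<bar> + real (card I) * R \<omega>)"
        using R(2)[OF \<omega>] by simp
    qed
  qed
  have FX: "integrable M FX" unfolding FX_def by (rule integrable_f[OF rv XR])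
  have FY: "integrable M FY" unfolding FY_def
    using XR R(2) by (intro integrable_f Y_rv) (auto simp: Y_def)
  have [measurable]: "FX \<in> borel_measurable M" "FY \<in> borel_measurable M" using FX FY by auto
  have diff: "\<bar>FX \<omega> - FY \<omega>\<bar> \<le> b * sqrt (S \<omega>)" for \<omega>
  proof -
    have "\<bar>FX \<omega> - FY \<omega>\<bar> \<le> L2_set (\<lambda>i. X i \<omega> - Y i \<omega>) I"
      using L unfolding lipschitz_coords_def FX_def FY_def by simp
    also have "\<dots> = sqrt (\<Sum>i\<in>I. b\<^sup>2 * W i \<omega>)"
      unfolding L2_set_def using b by (intro arg_cong[where f = sqrt] sum.cong) (auto simp: Y_def W_def power_divide)
    also have "\<dots> = b * sqrt (S \<omega>)"
      using b by (simp add: S_def sum_distrib_left[symmetric] real_sqrt_mult)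
    finally show ?thesis .
  qed
  have mean: "\<bar>expectation FX - expectation FY\<bar> \<le> b * mean_const"
  proof -
    have "ennreal \<bar>expectation FX - expectation FY\<bar> = ennreal (norm (expectation (\<lambda>\<omega>. FX \<omega> - FY \<omega>)))"
      using FX FY by simp
    also have "\<dots> \<le> (\<integral>\<^sup>+\<omega>. norm (FX \<omega> - FY \<omega>) \<partial>M)"
      using FX FY by (intro integral_norm_bound_ennreal) simp
    also have "\<dots> \<le> (\<integral>\<^sup>+\<omega>. ennreal b * (1 + (\<Sum>i\<in>I. ennreal (1 + 1 / \<Psi> 1) * ennreal (orlicz_weight (W i \<omega>)))) \<partial>M)"
    proof (intro nn_integral_mono)
      fix \<omega>
      have "norm (FX \<omega> - FY \<omega>) \<le> b * sqrt (S \<omega>)" using diff by simp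
      also have "\<dots> \<le> b * (1 + S \<omega>)"
        using b S0[of \<omega>] by (intro mult_left_mono real_le_lsqrt) (auto simp: power2_eq_square algebra_simps)
      also have "\<dots> \<le> b * (1 + (\<Sum>i\<in>I. (1 + 1 / \<Psi> 1) * orlicz_weight (W i \<omega>)))"
        unfolding S_def using b W0 by (intro mult_left_mono add_left_mono sum_mono le_orlicz_weight) auto
      finally have "ennreal (norm (FX \<omega> - FY \<omega>)) \<le> ennreal (b * (1 + (\<Sum>i\<in>I. (1 + 1 / \<Psi> 1) * orlicz_weight (W i \<omega>))))"
        by (rule ennreal_leI)
      also have "\<dots> = ennreal b * (1 + (\<Sum>i\<in>I. ennreal (1 + 1 / \<Psi> 1) * ennreal (orlicz_weight (W i \<omega>))))"
      proof -
        have k: "0 \<le> 1 + 1 / \<Psi> 1" using orlicz_one_pos by (simp add: add_nonneg_nonneg)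
        have "(\<Sum>i\<in>I. ennreal (1 + 1 / \<Psi> 1) * ennreal (orlicz_weight (W i \<omega>)))
            = (\<Sum>i\<in>I. ennreal ((1 + 1 / \<Psi> 1) * orlicz_weight (W i \<omega>)))"
          by (intro sum.cong refl ennreal_mult[symmetric] k orlicz_weight_nonneg)
        also have "\<dots> = ennreal (\<Sum>i\<in>I. (1 + 1 / \<Psi> 1) * orlicz_weight (W i \<omega>))"
          by (intro sum_ennreal mult_nonneg_nonneg k orlicz_weight_nonneg)
        finally have sum_eq: "(\<Sum>i\<in>I. ennreal (1 + 1 / \<Psi> 1) * ennreal (orlicz_weight (W i \<omega>)))
            = ennreal (\<Sum>i\<in>I. (1 + 1 / \<Psi> 1) * orlicz_weight (W i \<omega>))" .
        have "0 \<le> (\<Sum>i\<in>I. (1 + 1 / \<Psi> 1) * orlicz_weight (W i \<omega>))"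
          by (intro sum_nonneg mult_nonneg_nonneg k orlicz_weight_nonneg)
        then show ?thesis
          unfolding sum_eq using b by (simp only: ennreal_mult ennreal_plus ennreal_1 zero_le_one add_nonneg_nonneg less_imp_le)
      qed
      finally show "ennreal (norm (FX \<omega> - FY \<omega>))
        \<le> ennreal b * (1 + (\<Sum>i\<in>I. ennreal (1 + 1 / \<Psi> 1) * ennreal (orlicz_weight (W i \<omega>))))" .
    qed
    also have "\<dots> = ennreal b * (1 + ennreal (1 + 1 / \<Psi> 1) * (\<Sum>i\<in>I. \<integral>\<^sup>+\<omega>. ennreal (orlicz_weight (W i \<omega>)) \<partial>M))"
    proof -
      have [measurable]: "i \<in> I \<Longrightarrow> W i \<in> borel_measurable M" for i unfolding W_def by measurable
      have "(\<integral>\<^sup>+\<omega>. (\<Sum>i\<in>I. ennreal (1 + 1 / \<Psi> 1) * ennreal (orlicz_weight (W i \<omega>))) \<partial>M)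
         = (\<Sum>i\<in>I. \<integral>\<^sup>+\<omega>. ennreal (1 + 1 / \<Psi> 1) * ennreal (orlicz_weight (W i \<omega>)) \<partial>M)"
        by (rule nn_integral_sum) measurable
      also have "\<dots> = (\<Sum>i\<in>I. ennreal (1 + 1 / \<Psi> 1) * (\<integral>\<^sup>+\<omega>. ennreal (orlicz_weight (W i \<omega>)) \<partial>M))"
        by (intro sum.cong refl nn_integral_cmult) measurable
      finally show ?thesis
        by (subst nn_integral_cmult, measurable, subst nn_integral_add)
          (auto simp: emeasure_space_1 sum_distrib_left)
    qed
    also have "\<dots> \<le> ennreal b * (1 + ennreal (1 + 1 / \<Psi> 1) * 4)"
      by (intro mult_left_mono add_left_mono weights) auto
    also have "\<dots> = ennreal (b * mean_const)"
    proof -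
      have "ennreal (b * mean_const) = ennreal b * (ennreal 1 + ennreal (1 + 1 / \<Psi> 1) * ennreal 4)"
        using b orlicz_one_pos unfolding mean_const_def
        by (subst ennreal_mult[symmetric], simp, simp, subst ennreal_plus[symmetric], simp, simp,
            subst ennreal_mult[symmetric]) (simp_all add: mult.commute)
      then show ?thesis by simp
    qed
    finally show ?thesis
      using b orlicz_one_pos by (subst (asm) ennreal_le_iff) (auto simp: mean_const_def)
  qed
  have mc: "0 \<le> mean_const" using orlicz_one_pos by (simp add: mean_const_def)
  have t3: "b * mean_const \<le> t / 3"
  proof -
    have "9 * mean_const\<^sup>2 \<le> threshold" using tail_const_pos by (simp add: threshold_def)
    then have "(3 * mean_const)\<^sup>2 \<le> (t / b)\<^sup>2" using t by (simp add: power_mult_distrib)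
    then have "3 * mean_const \<le> t / b" by (rule power2_le_imp_le) (use t(1) b(1) in simp)
    then show ?thesis using b(1) by (simp add: field_simps)
  qed
  have tau: "K \<le> \<tau>" "tail_const * K * \<tau> = (t / b)\<^sup>2 / 9"
  proof -
    have "9 * (tail_const * K) * K \<le> threshold" by (simp add: threshold_def power2_eq_square)
    then have "9 * (tail_const * K) * K \<le> (t / b)\<^sup>2" using t by simp
    then show "K \<le> \<tau>" using K tail_const_pos by (simp add: \<tau>_def pos_le_divide_eq mult_ac)
    show "tail_const * K * \<tau> = (t / b)\<^sup>2 / 9" using K tail_const_pos by (simp add: \<tau>_def)
  qed
  have subset: "{\<omega> \<in> space M. \<bar>FX \<omega> - expectation FX\<bar> > t}
     \<subseteq> {\<omega> \<in> space M. \<bar>FY \<omega> - expectation FY\<bar> > t / 3} \<union> {\<omega> \<in> space M. S \<omega> \<ge> tail_const * K * \<tau>}"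
  proof (rule subsetI, rule ccontr)
    fix \<omega> assume \<omega>: "\<omega> \<in> {\<omega> \<in> space M. \<bar>FX \<omega> - expectation FX\<bar> > t}"
      and n: "\<omega> \<notin> {\<omega> \<in> space M. \<bar>FY \<omega> - expectation FY\<bar> > t / 3} \<union> {\<omega> \<in> space M. S \<omega> \<ge> tail_const * K * \<tau>}"
    have "S \<omega> \<le> (t / b / 3)\<^sup>2" using \<omega> n tau(2) by (simp add: power_divide)
    then have "sqrt (S \<omega>) \<le> t / b / 3" using t b by (intro real_le_lsqrt) auto
    then have "b * sqrt (S \<omega>) \<le> t / 3" using b by (simp add: field_simps)
    then have "\<bar>FX \<omega> - FY \<omega>\<bar> \<le> t / 3" using diff[of \<omega>] by linarith
    moreover have "\<bar>FY \<omega> - expectation FY\<bar> \<le> t / 3" using \<omega> n by simp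
    moreover have "t < \<bar>FX \<omega> - expectation FX\<bar>" using \<omega> by simp
    ultimately show False using mean t3 by linarith
  qed
  have "prob {\<omega> \<in> space M. \<bar>FX \<omega> - expectation FX\<bar> > t}
    \<le> prob ({\<omega> \<in> space M. \<bar>FY \<omega> - expectation FY\<bar> > t / 3} \<union> {\<omega> \<in> space M. S \<omega> \<ge> tail_const * K * \<tau>})"
    by (rule finite_measure_mono[OF subset]) measurable
  also have "\<dots> \<le> prob {\<omega> \<in> space M. \<bar>FY \<omega> - expectation FY\<bar> > t / 3} + prob {\<omega> \<in> space M. S \<omega> \<ge> tail_const * K * \<tau>}"
    by (rule measure_Un_le) measurable
  also have "prob {\<omega> \<in> space M. \<bar>FY \<omega> - expectation FY\<bar> > t / 3} \<le> 2 * exp (- (t / 3)\<^sup>2 / (32 * a\<^sup>2))"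
    unfolding FY_def
  proof (rule convex_concentration_bounded[OF Y_indep I _ a L c])
    show "integrable M (\<lambda>\<omega>. f (\<lambda>i. Y i \<omega>))" using FY by (simp add: FY_def)
  qed (use t a in \<open>auto simp: Y_def\<close>)
  also have "- (t / 3)\<^sup>2 / (32 * a\<^sup>2) = - t\<^sup>2 / (1152 * (expectation R)\<^sup>2)"
    by (simp add: a_def power_divide power_mult_distrib)
  also have "prob {\<omega> \<in> space M. S \<omega> \<ge> tail_const * K * \<tau>} \<le> min 1 (5 / (1 + \<Psi> \<tau>))"
    using sum_tail_bound[OF M W_indep I(1) W0 weights tau(1)] by (simp add: S_def)
  finally show ?thesis by (simp add: FX_def)
qed

section \<open>The concentration inequality on a given sample space\<close>

text \<open>The three entries of the minimum serve the Gaussian term, the term with \<open>\<Psi>\<close> for deviations above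
the threshold, and the claim that the latter term is at least \<open>1\<close> for deviations below it.\<close>

definition concentration_rate :: real where
  "concentration_rate = min (1 / 1152) (min (1 / (180 * (tail_const * K))) (1 / (4 * threshold * (1 + \<Psi> 1))))"

lemma threshold_pos: "0 < threshold"
  using tail_const_pos K by (simp add: threshold_def add_nonneg_pos)

lemma concentration_rate_pos: "0 < concentration_rate"
  using tail_const_pos K threshold_pos orlicz_one_pos by (simp add: concentration_rate_def)

end

text \<open>Composition with the restriction to \<open>{..<N}\<close> turns functions on \<open>Rn N\<close> into functions on all
sequences.\<close>

lemma lipschitz_Rn_imp_lipschitz_coords:
  assumes "lipschitz_Rn L N f"
  shows "lipschitz_coords {..<N} L (\<lambda>x. f (\<lambda>i\<in>{..<N}. x i))"
  unfolding lipschitz_coords_def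
proof (intro allI)
  fix x y :: "nat \<Rightarrow> real"
  have "L2_set (\<lambda>i. (\<lambda>i\<in>{..<N}. x i) i - (\<lambda>i\<in>{..<N}. y i) i) {..<N} = L2_set (\<lambda>i. x i - y i) {..<N}"
    by (rule L2_set_cong) simp_all
  moreover have "(\<lambda>i\<in>{..<N}. x i) \<in> Rn N" "(\<lambda>i\<in>{..<N}. y i) \<in> Rn N" by (auto simp: Rn_def)
  ultimately show "\<bar>f (\<lambda>i\<in>{..<N}. x i) - f (\<lambda>i\<in>{..<N}. y i)\<bar> \<le> L * L2_set (\<lambda>i. x i - y i) {..<N}"
    using assms unfolding lipschitz_Rn_def by metis
qed

lemma convex_Rn_imp_convex_coords:
  assumes "convex_Rn N f"
  shows "convex_coords (\<lambda>x. f (\<lambda>i\<in>{..<N}. x i))"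
  unfolding convex_coords_def
proof (intro allI ballI)
  fix x y :: "nat \<Rightarrow> real" and u :: real assume u: "u \<in> {0..1}"
  have "(\<lambda>i\<in>{..<N}. (1 - u) * x i + u * y i) = (\<lambda>i\<in>{..<N}. (1 - u) * (\<lambda>i\<in>{..<N}. x i) i + u * (\<lambda>i\<in>{..<N}. y i) i)"
    by (auto simp: fun_eq_iff)
  moreover have "(\<lambda>i\<in>{..<N}. x i) \<in> Rn N" "(\<lambda>i\<in>{..<N}. y i) \<in> Rn N" by (auto simp: Rn_def)
  ultimately show "f (\<lambda>i\<in>{..<N}. (1 - u) * x i + u * y i) \<le> (1 - u) * f (\<lambda>i\<in>{..<N}. x i) + u * f (\<lambda>i\<in>{..<N}. y i)"
    using assms u unfolding convex_Rn_def by metis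
qed

lemma abs_le_max_abs: "i < N \<Longrightarrow> \<bar>X i \<omega>\<bar> \<le> max_abs N X \<omega>"
  by (simp add: max_abs_def)

lemma max_abs_nonneg: "N \<ge> 1 \<Longrightarrow> 0 \<le> max_abs N X \<omega>"
  using abs_le_max_abs[of 0 N X \<omega>] by force

lemma borel_measurable_max_abs:
  assumes "\<And>i. i < N \<Longrightarrow> X i \<in> borel_measurable M"
  shows "max_abs N X \<in> borel_measurable M"
  unfolding max_abs_def[abs_def] using assms by (intro borel_measurable_Max) auto

text \<open>Passing to twice the norm avoids the question whether the infimum that defines the norm is attained, at
the price of a constant.\<close>

lemma orlicz_norm_doubled_admissible:
  assumes \<Phi>: "mono_on {0..} \<Phi>"
    and fin: "orlicz_norm \<Phi> M Y < \<infinity>" and pos: "0 < enn2real (orlicz_norm \<Phi> M Y)"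
  shows "(\<integral>\<^sup>+\<omega>. ennreal (\<Phi> (\<bar>Y \<omega>\<bar> / (2 * enn2real (orlicz_norm \<Phi> M Y)))) \<partial>M) \<le> 1"
proof -
  define \<rho> where "\<rho> = enn2real (orlicz_norm \<Phi> M Y)"
  have \<rho>: "0 < \<rho>" "orlicz_norm \<Phi> M Y = ennreal \<rho>" using fin pos by (auto simp: \<rho>_def)
  then have "orlicz_norm \<Phi> M Y < ennreal (2 * \<rho>)" by (simp add: ennreal_less_iff)
  then obtain a where a: "0 < a" "(\<integral>\<^sup>+\<omega>. ennreal (\<Phi> (\<bar>Y \<omega>\<bar> / a)) \<partial>M) \<le> 1" "ennreal a < ennreal (2 * \<rho>)"
    unfolding orlicz_norm_def Inf_less_iff by blast
  have "a < 2 * \<rho>" using a by (simp add: ennreal_less_iff)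
  then have "(\<integral>\<^sup>+\<omega>. ennreal (\<Phi> (\<bar>Y \<omega>\<bar> / (2 * \<rho>))) \<partial>M) \<le> (\<integral>\<^sup>+\<omega>. ennreal (\<Phi> (\<bar>Y \<omega>\<bar> / a)) \<partial>M)"
    using a \<rho> by (intro nn_integral_mono ennreal_leI mono_onD[OF \<Phi>]) (auto intro!: divide_left_mono)
  with a(2) show ?thesis by (simp add: \<rho>_def)
qed

context orlicz_growth
begin

text \<open>The right-hand side is at least \<open>1\<close> if the mean or the Orlicz norm of the maximum vanishes, and for
deviations below the threshold. A mean that is not \<open>0\<close> also shows that the maximum is integrable, as
the integral of a non-integrable function is \<open>0\<close>. In the remaining case the prefactor \<open>5\<close> of the tail
bound is traded for a smaller argument: by convexity \<open>\<Psi> (\<tau> / 5) \<le> \<Psi> \<tau> / 5\<close>.\<close>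

theorem convex_concentration_at_rate:
  fixes M :: "'a measure"
  assumes M: "prob_space M" and \<Phi>: "\<And>x. 0 \<le> x \<Longrightarrow> \<Phi> x = \<Psi> (x\<^sup>2)"
  shows "convex_concentration \<Phi> concentration_rate M"
  unfolding convex_concentration_def
proof (intro allI impI)
  interpret prob_space M by (rule M)
  fix N X and f :: "(nat \<Rightarrow> real) \<Rightarrow> real" and t :: real
  assume N: "1 \<le> N" and t: "0 < t" and indep: "indep_vars (\<lambda>_. borel) X {..<N}"
    and fin: "orlicz_norm \<Phi> M (max_abs N X) < \<infinity>"
    and f: "convex_Rn N f" "lipschitz_Rn 1 N f"
  define R where "R = max_abs N X"
  define m where "m = expectation R"
  define \<rho> where "\<rho> = enn2real (orlicz_norm \<Phi> M R)"
  let ?c = concentration_rate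
  let ?P = "prob {\<omega> \<in> space M. \<bar>f (rvec N X \<omega>) - expectation (\<lambda>\<omega>'. f (rvec N X \<omega>'))\<bar> > t}"
  have rv [measurable]: "i < N \<Longrightarrow> X i \<in> borel_measurable M" for i
    using indep by (auto simp: indep_vars_def)
  have R0: "0 \<le> R \<omega>" for \<omega> unfolding R_def by (rule max_abs_nonneg[OF N])
  have m0: "0 \<le> m" using R0 by (simp add: m_def)
  have \<rho>0: "0 \<le> \<rho>" by (simp add: \<rho>_def)
  have c: "0 < ?c" "?c \<le> 1 / 1152" "?c \<le> 1 / (180 * (tail_const * K))" "?c \<le> 1 / (4 * threshold * (1 + \<Psi> 1))"
    using concentration_rate_pos by (auto simp: concentration_rate_def)
  define v where "v = (?c * (t / \<rho>))\<^sup>2"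
  have \<Phi>v: "\<Phi> (?c * (t / \<rho>)) = \<Psi> v" using c t \<rho>0 by (simp add: \<Phi> v_def)
  have v0: "0 \<le> v" "0 \<le> \<Psi> v" by (auto simp: v_def orlicz_nonneg)
  have "?P \<le> 2 * exp (- ?c * (t\<^sup>2 / m\<^sup>2)) + 2 / (\<Psi> v + 1)"
  proof (cases "m = 0 \<or> \<Psi> v \<le> 1")
    case True
    then show ?thesis
    proof
      assume "m = 0"
      then have "2 \<le> 2 * exp (- ?c * (t\<^sup>2 / m\<^sup>2)) + 2 / (\<Psi> v + 1)" using v0 by simp
      then show ?thesis using prob_le_1[of "{\<omega> \<in> space M. \<bar>f (rvec N X \<omega>) - expectation (\<lambda>\<omega>'. f (rvec N X \<omega>'))\<bar> > t}"] by linarith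
    next
      assume "\<Psi> v \<le> 1"
      then have "1 \<le> 2 / (\<Psi> v + 1)" using v0 by simp
      moreover have "0 \<le> 2 * exp (- ?c * (t\<^sup>2 / m\<^sup>2))" by simp
      ultimately show ?thesis using prob_le_1[of "{\<omega> \<in> space M. \<bar>f (rvec N X \<omega>) - expectation (\<lambda>\<omega>'. f (rvec N X \<omega>'))\<bar> > t}"] by linarith
    qed
  next
    case False
    then have m: "0 < m" and v: "1 < \<Psi> v" using m0 by auto
    have \<rho>: "0 < \<rho>"
    proof (rule ccontr)
      assume "\<not> 0 < \<rho>"
      then have "v = 0" using \<rho>0 by (simp add: v_def)
      then show False using v orlicz by (simp add: orlicz_function_def)
    qed
    have R: "integrable M R" using m not_integrable_integral_eq[of M R] by (auto simp: m_def)
    define b where "b = 2 * \<rho>"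
    have b: "0 < b" using \<rho> by (simp add: b_def)
    have "mono_on {0..} \<Phi>"
      using \<Phi> by (intro mono_onI) (auto intro!: orlicz_mono)
    from orlicz_norm_doubled_admissible[OF this, of M R] fin \<rho>
    have "(\<integral>\<^sup>+\<omega>. ennreal (\<Phi> (\<bar>R \<omega>\<bar> / b)) \<partial>M) \<le> 1" by (simp add: b_def \<rho>_def R_def)
    then have bR: "(\<integral>\<^sup>+\<omega>. ennreal (\<Psi> ((R \<omega> / b)\<^sup>2)) \<partial>M) \<le> 1" using R0 b by (simp add: \<Phi>)
    define z where "z = (t / b)\<^sup>2"
    have vz: "v \<le> 4 * ?c * z"
    proof -
      have "v = 4 * ?c * z * ?c" using \<rho> by (simp add: v_def z_def b_def power2_eq_square)
      also have "\<dots> \<le> 4 * ?c * z * 1" using c by (intro mult_left_mono) (auto simp: z_def)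
      finally show ?thesis by simp
    qed
    have z: "threshold < z"
    proof (rule ccontr)
      assume "\<not> threshold < z"
      then have "4 * ?c * z \<le> 4 * (1 / (4 * threshold * (1 + \<Psi> 1))) * threshold"
        using c threshold_pos orlicz_one_pos by (intro mult_mono) (auto simp: z_def)
      also have "\<dots> = 1 / (1 + \<Psi> 1)" using threshold_pos by simp
      finally have "\<Psi> v \<le> \<Psi> (1 / (1 + \<Psi> 1) * 1)" using vz v0 by (intro orlicz_mono) auto
      also have "\<dots> \<le> 1 / (1 + \<Psi> 1) * \<Psi> 1" using orlicz_one_pos by (intro orlicz_contract) auto
      also have "\<dots> \<le> 1" using orlicz_one_pos by simp
      finally show False using v by simp
    qed
    define \<tau> where "\<tau> = z / (9 * (tail_const * K))"
    have CK: "0 < tail_const * K" using tail_const_pos K by simp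
    have v\<tau>: "v \<le> 1 / 5 * \<tau>"
    proof -
      have "4 * ?c * z \<le> 4 * (1 / (180 * (tail_const * K))) * z"
        by (intro mult_right_mono mult_left_mono c(3)) (auto simp: z_def)
      also have "\<dots> = 1 / 5 * \<tau>" by (simp add: \<tau>_def)
      finally show ?thesis using vz by simp
    qed
    have \<tau>0: "0 \<le> \<tau>" using CK by (simp add: \<tau>_def z_def)
    have "\<Psi> v \<le> \<Psi> (1 / 5 * \<tau>)" by (rule orlicz_mono[OF v0(1) v\<tau>])
    also have "\<dots> \<le> 1 / 5 * \<Psi> \<tau>" using \<tau>0 by (intro orlicz_contract) auto
    finally have \<Psi>\<tau>: "5 * \<Psi> v \<le> \<Psi> \<tau>" by simp
    have second: "min 1 (5 / (1 + \<Psi> \<tau>)) \<le> 2 / (\<Psi> v + 1)"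
      using \<Psi>\<tau> v by (intro min.coboundedI2) (simp add: divide_simps)
    have "0 \<in> {..<N}" using N by simp
    then have ne: "{..<N} \<noteq> {}" by blast
    have "?P \<le> 2 * exp (- t\<^sup>2 / (1152 * m\<^sup>2)) + min 1 (5 / (1 + \<Psi> \<tau>))"
      unfolding rvec_def m_def \<tau>_def z_def
    proof (rule convex_concentration_truncation[OF M indep _ ne _ R _ _ b bR])
      show "lipschitz_coords {..<N} 1 (\<lambda>x. f (\<lambda>i\<in>{..<N}. x i))"
        by (rule lipschitz_Rn_imp_lipschitz_coords[OF f(2)])
      show "convex_coords (\<lambda>x. f (\<lambda>i\<in>{..<N}. x i))"
        by (rule convex_Rn_imp_convex_coords[OF f(1)])
      show "\<bar>X i \<omega>\<bar> \<le> R \<omega>" if "i \<in> {..<N}" for i \<omega>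
        unfolding R_def by (rule abs_le_max_abs) (use that in simp)
    qed (use N R0 m t z in \<open>auto simp: m_def z_def\<close>)
    also have "2 * exp (- t\<^sup>2 / (1152 * m\<^sup>2)) \<le> 2 * exp (- ?c * (t\<^sup>2 / m\<^sup>2))"
    proof -
      have "?c * (t\<^sup>2 / m\<^sup>2) \<le> 1 / 1152 * (t\<^sup>2 / m\<^sup>2)" by (intro mult_right_mono c) simp
      then show ?thesis by simp
    qed
    also note second
    finally show ?thesis by simp
  qed
  then show "?P \<le> 2 * exp (- ?c * (t\<^sup>2 / (\<integral>\<omega>. max_abs N X \<omega> \<partial>M)\<^sup>2))
      + 2 / (\<Phi> (?c * (t / enn2real (orlicz_norm \<Phi> M (max_abs N X)))) + 1)"
    using \<Phi>v by (simp add: m_def R_def \<rho>_def)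
qed

end

section \<open>Independence of the sample space\<close>

text \<open>The inequality depends on \<open>X\<close> only through the joint law of its coordinates, which is also the law of
the coordinate functions on the space of real sequences.\<close>

lemma convex_concentration_transfer:
  fixes M :: "'a measure"
  assumes mono: "mono_on {0..} \<Phi>"
    and canonical: "\<And>M' :: (nat \<Rightarrow> real) measure. prob_space M' \<Longrightarrow> convex_concentration \<Phi> c M'"
    and M: "prob_space M"
  shows "convex_concentration \<Phi> c M"
  unfolding convex_concentration_def
proof (intro allI impI)
  interpret prob_space M by (rule M)
  fix N X and f :: "(nat \<Rightarrow> real) \<Rightarrow> real" and t :: real
  assume N: "1 \<le> N" and t: "0 < t" and indep: "indep_vars (\<lambda>_. borel) X {..<N}"
    and fin: "orlicz_norm \<Phi> M (max_abs N X) < \<infinity>"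
    and f: "convex_Rn N f" "lipschitz_Rn 1 N f"
  have rv: "i < N \<Longrightarrow> X i \<in> borel_measurable M" for i
    using indep by (auto simp: indep_vars_def)
  define T where "T = (\<lambda>\<omega> i. if i < N then X i \<omega> else 0)"
  define S where "S = PiM UNIV (\<lambda>_ :: nat. borel :: real measure)"
  define M' where "M' = distr M S T"
  define C where "C = (\<lambda>(i :: nat) (x :: nat \<Rightarrow> real). x i)"
  have C: "C i \<in> borel_measurable S" for i unfolding C_def S_def by measurable
  have T: "T \<in> M \<rightarrow>\<^sub>M S"
    unfolding S_def
  proof (rule measurable_PiM_single')
    show "(\<lambda>\<omega>. T \<omega> i) \<in> borel_measurable M" for i
      using rv by (cases "i < N") (auto simp: T_def)
  qed (auto simp: space_PiM)
  interpret M': prob_space M' unfolding M'_def by (rule prob_space_distr[OF T])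
  have ne: "{..<N} \<noteq> {}"
  proof -
    have "0 \<in> {..<N}" using N by simp
    then show ?thesis by blast
  qed
  have coords: "C i (T \<omega>) = X i \<omega>" if "i < N" for i \<omega> using that by (simp add: C_def T_def)
  have CM: "C i \<in> borel_measurable M'" for i using C by (simp add: M'_def)
  have indep': "M'.indep_vars (\<lambda>_. borel) C {..<N}"
  proof (subst M'.indep_vars_iff_distr_eq_PiM'[OF ne])
    have r: "(\<lambda>x. \<lambda>i\<in>{..<N}. C i x) \<in> S \<rightarrow>\<^sub>M PiM {..<N} (\<lambda>_. borel)"
      by (rule measurable_restrict) (rule C)
    have "distr M' (PiM {..<N} (\<lambda>_. borel)) (\<lambda>x. \<lambda>i\<in>{..<N}. C i x)
        = distr M (PiM {..<N} (\<lambda>_. borel)) (\<lambda>\<omega>. \<lambda>i\<in>{..<N}. C i (T \<omega>))"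
      unfolding M'_def by (subst distr_distr[OF r T]) (simp add: comp_def)
    also have "\<dots> = distr M (PiM {..<N} (\<lambda>_. borel)) (\<lambda>\<omega>. \<lambda>i\<in>{..<N}. X i \<omega>)"
      by (intro distr_cong) (auto simp: coords)
    also have "\<dots> = PiM {..<N} (\<lambda>i. distr M borel (X i))"
      using indep_vars_iff_distr_eq_PiM'[OF ne, where M' = "\<lambda>_. borel" and X = X] rv indep by simp
    also have "\<dots> = PiM {..<N} (\<lambda>i. distr M' borel (C i))"
    proof (rule PiM_cong)
      fix i assume "i \<in> {..<N}"
      then show "distr M borel (X i) = distr M' borel (C i)"
        unfolding M'_def by (subst distr_distr[OF C T]) (auto simp: comp_def coords intro!: distr_cong)
    qed simp
    finally show "distr M' (PiM {..<N} (\<lambda>_. borel)) (\<lambda>x. \<lambda>i\<in>{..<N}. C i x)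
        = PiM {..<N} (\<lambda>i. distr M' borel (C i))" .
  qed (rule CM)
  have max_T: "max_abs N C (T \<omega>) = max_abs N X \<omega>" for \<omega>
    unfolding max_abs_def by (intro arg_cong[where f = Max] image_cong) (auto simp: coords)
  have max_meas: "max_abs N C \<in> borel_measurable S"
    by (rule borel_measurable_max_abs) (rule C)
  have mean_max: "(\<integral>x. max_abs N C x \<partial>M') = (\<integral>\<omega>. max_abs N X \<omega> \<partial>M)"
    unfolding M'_def by (subst integral_distr[OF T max_meas]) (simp add: max_T)
  have norm: "orlicz_norm \<Phi> M' (max_abs N C) = orlicz_norm \<Phi> M (max_abs N X)"
  proof -
    have "(\<integral>\<^sup>+x. ennreal (\<Phi> (\<bar>max_abs N C x\<bar> / a)) \<partial>M') = (\<integral>\<^sup>+\<omega>. ennreal (\<Phi> (\<bar>max_abs N X \<omega>\<bar> / a)) \<partial>M)"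
      if a: "0 < a" for a
    proof -
      have "mono (\<lambda>y. \<Phi> (max 0 y))" by (intro monoI mono_onD[OF mono]) auto
      from borel_measurable_mono[OF this] max_meas
      have "(\<lambda>x. \<Phi> (max 0 (\<bar>max_abs N C x\<bar> / a))) \<in> borel_measurable S" by measurable
      moreover have "max 0 (\<bar>y\<bar> / a) = \<bar>y\<bar> / a" for y using a by (simp add: max_absorb2)
      ultimately have m: "(\<lambda>x. \<Phi> (\<bar>max_abs N C x\<bar> / a)) \<in> borel_measurable S" by simp
      show ?thesis
        unfolding M'_def using m by (subst nn_integral_distr[OF T]) (auto simp: max_T)
    qed
    then show ?thesis unfolding orlicz_norm_def by (simp cong: conj_cong)
  qed
  have rvec_T: "rvec N C (T \<omega>) = rvec N X \<omega>" for \<omega>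
    unfolding rvec_def by (auto simp: coords fun_eq_iff)
  have f_meas: "(\<lambda>x. f (rvec N C x)) \<in> borel_measurable S"
    unfolding rvec_def
    using borel_measurable_lipschitz_compose[OF lipschitz_Rn_imp_lipschitz_coords[OF f(2)], of C S] C by simp
  have mean_f: "(\<integral>x. f (rvec N C x) \<partial>M') = (\<integral>\<omega>. f (rvec N X \<omega>) \<partial>M)"
    unfolding M'_def by (subst integral_distr[OF T f_meas]) (simp add: rvec_T)
  have prob_eq: "measure M' {x \<in> space M'. \<bar>f (rvec N C x) - e\<bar> > t} = prob {\<omega> \<in> space M. \<bar>f (rvec N X \<omega>) - e\<bar> > t}" for e
  proof -
    have "{x \<in> space S. \<bar>f (rvec N C x) - e\<bar> > t} \<in> sets S"
      using f_meas by measurable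
    then have "measure M' {x \<in> space S. \<bar>f (rvec N C x) - e\<bar> > t}
        = prob (T -` {x \<in> space S. \<bar>f (rvec N C x) - e\<bar> > t} \<inter> space M)"
      unfolding M'_def by (rule measure_distr[OF T])
    also have "T -` {x \<in> space S. \<bar>f (rvec N C x) - e\<bar> > t} \<inter> space M = {\<omega> \<in> space M. \<bar>f (rvec N X \<omega>) - e\<bar> > t}"
      using measurable_space[OF T] by (auto simp: rvec_T)
    finally show ?thesis by (simp add: M'_def)
  qed
  have "convex_concentration \<Phi> c M'" by (rule canonical) unfold_locales
  from this[unfolded convex_concentration_def, rule_format, OF N t indep' _ f] fin
  show "\<P>(\<omega> in M. \<bar>f (rvec N X \<omega>) - (\<integral>\<omega>'. f (rvec N X \<omega>') \<partial>M)\<bar> > t)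
      \<le> 2 * exp (- c * (t\<^sup>2 / (\<integral>\<omega>. max_abs N X \<omega> \<partial>M)\<^sup>2))
        + 2 / (\<Phi> (c * (t / enn2real (orlicz_norm \<Phi> M (max_abs N X)))) + 1)"
    by (simp add: norm mean_max mean_f prob_eq)
qed

text \<open>The constant in the conclusion is a choice among all positive constants that are valid for all probability
measures on real sequences. The explicit rate shows that there are such constants, but the chosen one
need not coincide with it; the transfer lemma applies to every choice.\<close>

theorem proposition4p7:
  fixes \<Psi> \<psi> \<Phi> :: "real \<Rightarrow> real"
  assumes "orlicz_function \<Psi>"
    and "\<And>x. x \<ge> 0 \<Longrightarrow> \<Psi> x = exp (\<psi> x) - 1"
    and "\<exists>K>0. \<forall>s\<ge>K. \<forall>u\<ge>K. \<psi> (s * u) \<le> K * (s * ln (1 + s) + s * \<psi> u)"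
    and "\<And>x. x \<ge> 0 \<Longrightarrow> \<Phi> x = \<Psi> (x\<^sup>2)"
  shows "0 < concentration_const \<Phi> \<and>
    (\<forall>(M :: 'a measure) N X f t.
       prob_space M \<longrightarrow>
       N \<ge> 1 \<longrightarrow>
       prob_space.indep_vars M (\<lambda>_. borel) X {..<N} \<longrightarrow>
       orlicz_norm \<Phi> M (max_abs N X) < \<infinity> \<longrightarrow>
       convex_Rn N f \<longrightarrow>
       lipschitz_Rn 1 N f \<longrightarrow>
       t > 0 \<longrightarrow>
       \<P>(\<omega> in M. \<bar>f (rvec N X \<omega>) - (\<integral>\<omega>'. f (rvec N X \<omega>') \<partial>M)\<bar> > t)
         \<le> 2 * exp (- concentration_const \<Phi> * (t\<^sup>2 / (\<integral>\<omega>. max_abs N X \<omega> \<partial>M)\<^sup>2))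
           + 2 / (\<Phi> (concentration_const \<Phi> * (t / enn2real (orlicz_norm \<Phi> M (max_abs N X)))) + 1))"
proof -
  obtain K0 where K0: "0 < K0"
      "\<And>s u. K0 \<le> s \<Longrightarrow> K0 \<le> u \<Longrightarrow> \<psi> (s * u) \<le> K0 * (s * ln (1 + s) + s * \<psi> u)"
    using assms(3) by blast
  interpret orlicz \<Psi> by (rule orlicz.intro) (rule assms(1))
  have \<psi>: "ln (1 + \<Psi> x) = \<psi> x" if "0 \<le> x" for x
    using assms(2)[OF that] by simp
  have \<psi>0: "0 \<le> \<psi> x" if "0 \<le> x" for x
    using orlicz_nonneg[OF that] \<psi>[OF that] by (metis ln_ge_zero le_add_same_cancel1)
  define K where "K = max K0 1"
  interpret orlicz_growth \<Psi> K
  proof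
    show "1 \<le> K" by (simp add: K_def)
    fix s u assume su: "K \<le> s" "K \<le> u"
    then have pos: "1 \<le> s" "1 \<le> u" by (auto simp: K_def)
    have "\<psi> (s * u) \<le> K0 * (s * ln (1 + s) + s * \<psi> u)"
      using su by (intro K0) (auto simp: K_def)
    also have "\<dots> \<le> K * (s * ln (1 + s) + s * \<psi> u)"
      using pos \<psi>0[of u] by (intro mult_right_mono) (auto simp: K_def)
    finally show "ln (1 + \<Psi> (s * u)) \<le> K * (s * ln (1 + s) + s * ln (1 + \<Psi> u))"
      using pos by (simp add: \<psi>)
  qed
  have "mono_on {0..} \<Phi>"
    using assms(4) by (intro mono_onI) (auto intro!: orlicz_mono)
  note transfer = convex_concentration_transfer[OF this]
  have "\<exists>c. 0 < c \<and> (\<forall>M :: (nat \<Rightarrow> real) measure. prob_space M \<longrightarrow> convex_concentration \<Phi> c M)"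
    using concentration_rate_pos convex_concentration_at_rate assms(4) by blast
  from someI_ex[OF this]
  have c: "0 < concentration_const \<Phi>"
    "\<And>M :: (nat \<Rightarrow> real) measure. prob_space M \<Longrightarrow> convex_concentration \<Phi> (concentration_const \<Phi>) M"
    unfolding concentration_const_def by blast+
  show ?thesis
    using c(1) transfer[OF c(2)] unfolding convex_concentration_def by blast
qed

end
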